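(* Let $(V,B)$ be a Steiner system of type $S(t,n,v)$, where $t<n\le v$, let $C=C_{(n,v)}\setminus B$, and let $X_C\subset\mathbb P^n$ be the Complement of the Steiner configuration of points with respect to a collection $\mathcal H=\{H_1,\dots,H_v\}$ of distinct hyperplanes of $\mathbb P^n$ any $n$ of which meet in a point. Then the Waldschmidt constant of $I_{X_C}$ is $$\widehat\alpha(I_{X_C})=\frac{v}{n}.$$
   Context: A Steiner system $(V,B)$ of type $S(t,n,v)$ consists of a set $V=\{1,\dots,v\}$ and a collection $B$ of $n$-subsets of $V$ (blocks) such that every $t$-subset of $V$ is contained in a unique block. $C_{(n,v)}$ denotes the set of all $n$-subsets of $V$. Let $H_j$ be defined by the linear form $\ell_j$ over the field $k$. For an $n$-subset $\sigma$ of $V$ put $P_\sigma=\bigcap_{i\in\sigma}H_i$, a point with ideal $I_{P_\sigma}=(\ell_i:i\in\sigma)\subseteq k[x_0,\dots,x_n]$. Then $X_C=\{P_\sigma:\sigma\in C\}$, $I_{X_C}=\bigcap_{\sigma\in C}I_{P_\sigma}$, and $I_{X_C}^{(m)}=\bigcap_{\sigma\in C}I_{P_\sigma}^m$ is the $m$-th symbolic power. For a homogeneous ideal $I$, $\alpha(I)$ is the minimum integer $d$ with $I_d\ne0$, and the Waldschmidt constant is $\widehat\alpha(I)=\lim_{m\to\infty}\alpha(I^{(m)})/m$.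
   Formalization: Added, since the claim fails without them: t > 0; different n-subsets of the hyperplanes meet in different points (no n+1 hyperplanes share a point); and X_C is nonempty (which excludes v = n). *)

theory Defs
  imports Complex_Main "HOL-Library.Poly_Mapping" "HOL-Library.Ramsey"
    "HOL-Algebra.Ideal_Product"
begin

section \<open>Steiner systems\<close>

text \<open>\<^term>\<open>nsets V n\<close> is the set of all \<open>n\<close>-subsets of \<open>V\<close>. The point set is \<open>{1..v}\<close>.\<close>

definition steiner_system :: "nat \<Rightarrow> nat \<Rightarrow> nat \<Rightarrow> nat set set \<Rightarrow> bool" where
  "steiner_system t n v B \<longleftrightarrow>
     B \<subseteq> nsets {1..v} n \<and> (\<forall>T\<in>nsets {1..v} t. \<exists>!b. b \<in> B \<and> T \<subseteq> b)"


section \<open>The polynomial ring in \<open>n + 1\<close> variables\<close>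

text \<open>A monomial is its exponent vector, and a polynomial is the finitely supported function
  of its coefficients. The type has a variable \<open>x\<^sub>i\<close> for every natural number \<open>i\<close>; the ring
  \<open>k[x\<^sub>0, \<dots>, x\<^sub>n]\<close> is cut out by its carrier, so that ideals are ideals of that ring.\<close>

type_synonym 'k mpoly = "(nat \<Rightarrow>\<^sub>0 nat) \<Rightarrow>\<^sub>0 'k"

definition poly_ring :: "nat \<Rightarrow> ('k::field) mpoly ring" where
  "poly_ring n =
     \<lparr>carrier = {p. \<forall>m\<in>Poly_Mapping.keys p. Poly_Mapping.keys m \<subseteq> {0..n}},
      mult = (*), one = 1, zero = 0, add = (+)\<rparr>"

lemma poly_ring_cring: "cring (poly_ring n :: ('k::field) mpoly ring)"
proof -
  let ?R = "poly_ring n :: 'k mpoly ring"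
  have R_simps: "mult ?R = (*)" "one ?R = 1" "zero ?R = 0" "add ?R = (+)"
    by (simp_all add: poly_ring_def)
  have in_carrier: "p \<in> carrier ?R \<longleftrightarrow>
      (\<forall>m\<in>Poly_Mapping.keys p. Poly_Mapping.keys m \<subseteq> {0..n})" for p
    by (simp add: poly_ring_def)
  have mult_closed: "p * q \<in> carrier ?R" if "p \<in> carrier ?R" "q \<in> carrier ?R" for p q
    unfolding in_carrier
  proof
    fix m assume "m \<in> Poly_Mapping.keys (p * q)"
    then obtain a b where "m = a + b" "a \<in> Poly_Mapping.keys p" "b \<in> Poly_Mapping.keys q"
      using keys_mult[of p q] by blast
    then show "Poly_Mapping.keys m \<subseteq> {0..n}"
      using that Poly_Mapping.keys_add[of a b] unfolding in_carrier by blast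
  qed
  have add_closed: "p + q \<in> carrier ?R" if "p \<in> carrier ?R" "q \<in> carrier ?R" for p q
    using that Poly_Mapping.keys_add[of p q] unfolding in_carrier by blast
  have uminus_closed: "- p \<in> carrier ?R" if "p \<in> carrier ?R" for p
    using that unfolding in_carrier by (simp add: keys.rep_eq)
  have zero_one_closed: "0 \<in> carrier ?R" "1 \<in> carrier ?R"
    by (simp_all add: in_carrier)
  have "abelian_group ?R"
  proof (rule abelian_groupI, unfold R_simps)
    show "\<exists>q\<in>carrier ?R. q + p = 0" if "p \<in> carrier ?R" for p
      using uminus_closed[OF that] by (intro bexI[of _ "- p"]) simp
  qed (simp_all add: add_closed zero_one_closed add.assoc add.commute)
  moreover have "Group.comm_monoid ?R"
    by (rule Group.comm_monoidI, unfold R_simps)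
       (simp_all add: mult_closed zero_one_closed mult.assoc mult.commute)
  ultimately show ?thesis
    by (rule cringI) (simp add: R_simps distrib_right)
qed

definition monom_degree :: "(nat \<Rightarrow>\<^sub>0 nat) \<Rightarrow> nat" where
  "monom_degree m = (\<Sum>i\<in>Poly_Mapping.keys m. Poly_Mapping.lookup m i)"

definition homogeneous :: "nat \<Rightarrow> 'k::field mpoly \<Rightarrow> bool" where
  "homogeneous d p \<longleftrightarrow> (\<forall>m\<in>Poly_Mapping.keys p. monom_degree m = d)"

definition eval_mpoly :: "(nat \<Rightarrow> 'k) \<Rightarrow> 'k::field mpoly \<Rightarrow> 'k" where
  "eval_mpoly x p = (\<Sum>m\<in>Poly_Mapping.keys p. Poly_Mapping.lookup p m *
                       (\<Prod>i\<in>Poly_Mapping.keys m. x i ^ Poly_Mapping.lookup m i))"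

definition linear_form :: "nat \<Rightarrow> 'k::field mpoly \<Rightarrow> bool" where
  "linear_form n l \<longleftrightarrow> l \<in> carrier (poly_ring n) \<and> homogeneous 1 l \<and> l \<noteq> 0"


section \<open>Projective space and hyperplanes\<close>

text \<open>A point of \<open>\<P>\<^sup>n(k)\<close> is the set of all its homogeneous coordinate vectors
  \<open>(x\<^sub>0, \<dots>, x\<^sub>n)\<close>, the latter extended by zero.\<close>

definition proj_space :: "nat \<Rightarrow> (nat \<Rightarrow> 'k::field) set set" where
  "proj_space n =
     {{\<lambda>i. c * x i | c. c \<noteq> 0} | x. (\<forall>i>n. x i = 0) \<and> (\<exists>i. x i \<noteq> 0)}"

definition hyperplane :: "nat \<Rightarrow> 'k::field mpoly \<Rightarrow> (nat \<Rightarrow> 'k) set set" where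
  "hyperplane n l = {P \<in> proj_space n. \<forall>x\<in>P. eval_mpoly x l = 0}"


section \<open>Configurations of points\<close>

text \<open>\<open>P\<^sub>\<sigma>\<close>, which is only meaningful if the hyperplanes indexed by \<open>\<sigma>\<close> meet in
  exactly one point.\<close>

definition config_point :: "nat \<Rightarrow> (nat \<Rightarrow> 'k::field mpoly) \<Rightarrow> nat set \<Rightarrow> (nat \<Rightarrow> 'k) set" where
  "config_point n l \<sigma> = the_elem (\<Inter>i\<in>\<sigma>. hyperplane n (l i))"

definition configuration ::
    "nat \<Rightarrow> (nat \<Rightarrow> 'k::field mpoly) \<Rightarrow> nat set set \<Rightarrow> (nat \<Rightarrow> 'k) set set" where
  "configuration n l C = config_point n l ` C"

definition point_ideal :: "nat \<Rightarrow> (nat \<Rightarrow> 'k::field mpoly) \<Rightarrow> nat set \<Rightarrow> 'k mpoly set" where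
  "point_ideal n l \<sigma> = Idl\<^bsub>poly_ring n\<^esub> (l ` \<sigma>)"

text \<open>The \<open>m\<close>-th symbolic power of the ideal of the configuration, which is its value for
  \<open>m = 1\<close>. The powers of the point ideals are taken in the monoid of ideals under the
  ideal product.\<close>

definition config_symbolic_power ::
    "nat \<Rightarrow> (nat \<Rightarrow> 'k::field mpoly) \<Rightarrow> nat set set \<Rightarrow> nat \<Rightarrow> 'k mpoly set" where
  "config_symbolic_power n l C m =
     {f \<in> carrier (poly_ring n).
        \<forall>\<sigma>\<in>C. f \<in> point_ideal n l \<sigma> [^]\<^bsub>ideals_set (poly_ring n)\<^esub> m}"


section \<open>Waldschmidt constants\<close>

definition initial_degree :: "'k::field mpoly set \<Rightarrow> nat" where
  "initial_degree I = (LEAST d. \<exists>f\<in>I. homogeneous d f \<and> f \<noteq> 0)"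

text \<open>The argument \<open>J\<close> is the sequence of symbolic powers of the ideal. The predicate
  includes the existence of the limit.\<close>

definition has_waldschmidt_constant :: "(nat \<Rightarrow> 'k::field mpoly set) \<Rightarrow> real \<Rightarrow> bool" where
  "has_waldschmidt_constant J w \<longleftrightarrow>
     (\<lambda>m. real (initial_degree (J m)) / real m) \<longlonglongrightarrow> w"

end

theory Submission
  imports Defs "HOL-Computational_Algebra.Polynomial"
begin

text \<open>Upper bound: the product of all \<open>v\<close> linear forms vanishes to order \<open>n\<close> at every \<open>P\<^sub>\<sigma>\<close>.

  Lower bound: let a nonzero form \<open>F\<close> of degree \<open>d\<close> vanish to order \<open>m\<close> at the points \<open>P\<^sub>\<sigma>\<close>. Divide
  \<open>F\<close> by the linear forms \<open>l\<^sub>j\<close> as often as possible, recording the exponents as weights \<open>w\<^sub>j\<close>;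
  the quotient still vanishes to order \<open>m - w(\<sigma>)\<close> at \<open>P\<^sub>\<sigma>\<close>, and \<open>deg F + w(V)\<close> is unchanged.
  Restrict the quotient to a hyperplane \<open>H\<^sub>i\<close> of minimal weight, where it is nonzero, and induct on
  \<open>n\<close>. On lines the argument shows \<open>d \<ge> c m\<close> as soon as each \<open>(n-1)\<close>-subset of \<open>V\<close> lies in at
  least \<open>c\<close> of the \<open>\<sigma>\<close>, and the induction step needs \<open>c \<le> v/n\<close>. A proper Steiner system has
  \<open>v \<ge> n + 2\<close>, so its complement has at least \<open>v - n \<ge> v/n\<close> members above each \<open>(n-1)\<close>-subset.\<close>

section \<open>Substitution into polynomials\<close>

definition const :: "'k::field \<Rightarrow> 'k mpoly" where
  "const c = Poly_Mapping.single 0 c"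

definition var :: "nat \<Rightarrow> 'k::field mpoly" where
  "var i = Poly_Mapping.single (Poly_Mapping.single i 1) 1"

text \<open>The variable set is arbitrary instead of \<open>{0..n}\<close>: restriction to a
  hyperplane eliminates one variable, not necessarily the last.\<close>

definition mpolys :: "nat set \<Rightarrow> 'k::field mpoly set" where
  "mpolys X = {p. \<forall>m\<in>Poly_Mapping.keys p. Poly_Mapping.keys m \<subseteq> X}"

definition monom_value :: "(nat \<Rightarrow> 'r::comm_ring_1) \<Rightarrow> (nat \<Rightarrow>\<^sub>0 nat) \<Rightarrow> 'r" where
  "monom_value g m = (\<Prod>i\<in>Poly_Mapping.keys m. g i ^ Poly_Mapping.lookup m i)"

text \<open>The coefficient map \<open>h\<close> makes evaluation at a vector, linear substitution
  and expansion around a point instances of one construction.\<close>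

definition mpoly_subst ::
    "('k \<Rightarrow> 'r::comm_ring_1) \<Rightarrow> (nat \<Rightarrow> 'r) \<Rightarrow> 'k::field mpoly \<Rightarrow> 'r" where
  "mpoly_subst h g p =
     (\<Sum>m\<in>Poly_Mapping.keys p. h (Poly_Mapping.lookup p m) * monom_value g m)"

section \<open>Homomorphisms of commutative rings\<close>

locale unital_hom =
  fixes h :: "'a::comm_ring_1 \<Rightarrow> 'b::comm_ring_1"
  assumes hom_add: "h (a + b) = h a + h b"
    and hom_mult: "h (a * b) = h a * h b"
    and hom_one: "h 1 = 1"
begin

lemma hom_zero: "h 0 = 0"
  using hom_add[of 0 0] by simp

lemma hom_uminus: "h (- a) = - h a"
  using hom_add[of "- a" a] hom_zero by (simp add: eq_neg_iff_add_eq_0)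

lemma hom_diff: "h (a - b) = h a - h b"
  using hom_add[of a "- b"] hom_uminus by simp

lemma hom_sum: "h (\<Sum>x\<in>S. f x) = (\<Sum>x\<in>S. h (f x))"
  by (induction S rule: infinite_finite_induct) (simp_all add: hom_zero hom_add)

lemma hom_power: "h (a ^ n) = h a ^ n"
  by (induction n) (simp_all add: hom_one hom_mult)

lemma hom_prod: "h (\<Prod>x\<in>S. f x) = (\<Prod>x\<in>S. h (f x))"
  by (induction S rule: infinite_finite_induct) (simp_all add: hom_one hom_mult)

lemma hom_dvd: "a dvd b \<Longrightarrow> h a dvd h b"
  by (auto simp: dvd_def hom_mult)

lemma hom_monom_value: "h (monom_value g m) = monom_value (\<lambda>i. h (g i)) m"
  by (simp add: monom_value_def hom_prod hom_power)

text \<open>This reduces identities between composed substitutions to a comparison on constants and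
  variables.\<close>

lemma hom_mpoly_subst: "h (mpoly_subst c g p) = mpoly_subst (\<lambda>x. h (c x)) (\<lambda>i. h (g i)) p"
  by (simp add: mpoly_subst_def hom_sum hom_mult hom_monom_value)

lemma unital_hom_map_poly: "unital_hom (map_poly h)"
proof
  show "map_poly h (p + q) = map_poly h p + map_poly h q" for p q
    by (rule poly_eqI) (simp add: coeff_map_poly hom_zero hom_add)
  show "map_poly h (p * q) = map_poly h p * map_poly h q" for p q
    by (rule poly_eqI) (simp add: coeff_map_poly hom_zero coeff_mult hom_sum hom_mult)
qed (simp add: hom_one)

end

section \<open>Monomials and decomposition of polynomials into terms\<close>

lemma monom_value_superset:
  assumes "finite S" "Poly_Mapping.keys m \<subseteq> S"
  shows "monom_value g m = (\<Prod>i\<in>S. g i ^ Poly_Mapping.lookup m i)"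
  unfolding monom_value_def using assms
  by (intro prod.mono_neutral_left) (auto simp: in_keys_iff)

lemma monom_value_add: "monom_value g (m + m') = monom_value g m * monom_value g m'"
proof -
  let ?S = "Poly_Mapping.keys m \<union> Poly_Mapping.keys m'"
  have "monom_value g (m + m') = (\<Prod>i\<in>?S. g i ^ Poly_Mapping.lookup (m + m') i)"
    using Poly_Mapping.keys_add[of m m'] by (intro monom_value_superset) auto
  then show ?thesis
    by (simp add: monom_value_superset[of ?S] lookup_add power_add prod.distrib)
qed

lemma monom_value_0 [simp]: "monom_value g 0 = 1"
  by (simp add: monom_value_def)

lemma monom_value_single [simp]: "monom_value g (Poly_Mapping.single i 1) = g i"
  by (simp add: monom_value_def)

lemma mpoly_sum_single:
  "(\<Sum>m\<in>Poly_Mapping.keys p. Poly_Mapping.single m (Poly_Mapping.lookup p m)) = p"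
  by (rule poly_mapping_eqI)
     (simp add: lookup_sum lookup_single when_def in_keys_iff)

lemma const_0 [simp]: "const 0 = 0"
  and const_1 [simp]: "const 1 = 1"
  by (simp_all add: const_def single_one)

lemma unital_hom_const: "unital_hom const"
  by unfold_locales (simp_all add: const_def single_add mult_single single_one)

lemma unital_hom_comp_const_pCons: "unital_hom (\<lambda>c. [:const c:])"
proof -
  interpret unital_hom const by (rule unital_hom_const)
  show ?thesis
    by unfold_locales (simp_all add: hom_add hom_mult hom_one one_pCons)
qed

lemma lookup_const_mult: "Poly_Mapping.lookup (const c * p) m = c * Poly_Mapping.lookup p m"
proof -
  have "const c * p = (\<Sum>m\<in>Poly_Mapping.keys p. const c * Poly_Mapping.single m (Poly_Mapping.lookup p m))"
    by (subst mpoly_sum_single[of p, symmetric]) (simp add: sum_distrib_left)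
  then show ?thesis
    by (simp add: const_def mult_single lookup_sum lookup_single when_def in_keys_iff)
qed

lemma monom_value_var: "monom_value var m = Poly_Mapping.single m (1::'k::field)"
proof -
  have pow: "Poly_Mapping.single (Poly_Mapping.single i 1) (1::'k) ^ k
      = Poly_Mapping.single (Poly_Mapping.single i k) 1" for i k :: nat
    by (induction k) (simp_all add: single_one mult_single flip: single_add)
  have "(\<Prod>i\<in>S. Poly_Mapping.single (Poly_Mapping.single i (Poly_Mapping.lookup m i)) (1::'k))
      = Poly_Mapping.single (\<Sum>i\<in>S. Poly_Mapping.single i (Poly_Mapping.lookup m i)) 1"
    if "finite S" for S
    using that by induction (simp_all add: single_one mult_single)
  moreover have "(\<Sum>i\<in>Poly_Mapping.keys m. Poly_Mapping.single i (Poly_Mapping.lookup m i)) = m"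
    by (rule poly_mapping_eqI) (simp add: lookup_sum lookup_single when_def in_keys_iff)
  ultimately show ?thesis
    by (simp add: monom_value_def var_def pow[unfolded One_nat_def])
qed

lemma mpoly_subst_var [simp]: "mpoly_subst const var p = p"
  by (subst (2) mpoly_sum_single[of p, symmetric])
     (simp add: mpoly_subst_def monom_value_var const_def mult_single)

lemma eval_mpoly_eq_subst: "eval_mpoly x = mpoly_subst (\<lambda>c. c) x"
  by (simp add: fun_eq_iff eval_mpoly_def mpoly_subst_def monom_value_def)

section \<open>Substitution as a ring homomorphism\<close>

locale field_hom = unital_hom h for h :: "'k::field \<Rightarrow> 'r::comm_ring_1"
begin

lemma mpoly_subst_superset:
  assumes "finite S" "Poly_Mapping.keys p \<subseteq> S"
  shows "mpoly_subst h g p = (\<Sum>m\<in>S. h (Poly_Mapping.lookup p m) * monom_value g m)"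
  unfolding mpoly_subst_def using assms
  by (intro sum.mono_neutral_left) (auto simp: in_keys_iff hom_zero)

lemma mpoly_subst_add: "mpoly_subst h g (p + q) = mpoly_subst h g p + mpoly_subst h g q"
proof -
  let ?S = "Poly_Mapping.keys p \<union> Poly_Mapping.keys q"
  have "mpoly_subst h g (p + q) =
      (\<Sum>m\<in>?S. h (Poly_Mapping.lookup (p + q) m) * monom_value g m)"
    using Poly_Mapping.keys_add[of p q] by (intro mpoly_subst_superset) auto
  then show ?thesis
    by (simp add: mpoly_subst_superset[of ?S] lookup_add hom_add distrib_right sum.distrib)
qed

lemma mpoly_subst_single: "mpoly_subst h g (Poly_Mapping.single m c) = h c * monom_value g m"
  by (subst mpoly_subst_superset[of "{m}"]) auto

lemma mpoly_subst_sum: "mpoly_subst h g (\<Sum>x\<in>S. f x) = (\<Sum>x\<in>S. mpoly_subst h g (f x))"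
  by (induction S rule: infinite_finite_induct) (simp_all add: mpoly_subst_add mpoly_subst_def[of h g 0])

lemma mpoly_subst_mult: "mpoly_subst h g (p * q) = mpoly_subst h g p * mpoly_subst h g q"
proof -
  let ?mon = "\<lambda>p m. Poly_Mapping.single m (Poly_Mapping.lookup p m)"
  have "p * q = (\<Sum>m\<in>Poly_Mapping.keys p. \<Sum>m'\<in>Poly_Mapping.keys q. ?mon p m * ?mon q m')"
    by (subst mpoly_sum_single[of p, symmetric], subst mpoly_sum_single[of q, symmetric])
       (simp only: sum_product)
  then have "mpoly_subst h g (p * q) =
      (\<Sum>m\<in>Poly_Mapping.keys p. \<Sum>m'\<in>Poly_Mapping.keys q.
        (h (Poly_Mapping.lookup p m) * monom_value g m) * (h (Poly_Mapping.lookup q m') * monom_value g m'))"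
    by (simp add: mpoly_subst_sum mult_single mpoly_subst_single hom_mult monom_value_add mult_ac)
  then show ?thesis
    by (simp add: mpoly_subst_def sum_product)
qed

lemma unital_hom_mpoly_subst: "unital_hom (mpoly_subst h g)"
proof
  show "mpoly_subst h g 1 = 1"
    using mpoly_subst_single[of g 0 1] by (simp add: single_one hom_one)
qed (simp_all add: mpoly_subst_add mpoly_subst_mult)

lemma mpoly_subst_const [simp]: "mpoly_subst h g (const c) = h c"
  by (simp add: const_def mpoly_subst_single)

lemma mpoly_subst_at_var [simp]: "mpoly_subst h g (var i) = g i"
  by (simp add: var_def mpoly_subst_single hom_one monom_value_single[unfolded One_nat_def])

end

lemma mpoly_subst_cong:
  assumes "p \<in> mpolys X" "\<And>i. i \<in> X \<Longrightarrow> g i = g' i"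
  shows "mpoly_subst h g p = mpoly_subst h g' p"
  unfolding mpoly_subst_def monom_value_def using assms
  by (intro sum.cong prod.cong arg_cong2[of _ _ _ _ "(*)"]) (auto simp: mpolys_def subset_iff)

lemma dvd_diff_mult:
  fixes d :: "'r::comm_ring_1"
  assumes "d dvd a - a'" "d dvd b - b'"
  shows "d dvd a * b - a' * b'"
proof -
  have "a * b - a' * b' = a * (b - b') + (a - a') * b'"
    by (simp add: algebra_simps)
  then show ?thesis
    using assms by simp
qed

text \<open>Polynomial expressions respect congruence modulo \<open>d\<close>, since sums, products
  and powers do.\<close>

lemma dvd_diff_mpoly_subst:
  fixes d :: "'r::comm_ring_1"
  assumes "\<And>i. d dvd g i - g' i"
  shows "d dvd mpoly_subst h g p - mpoly_subst h g' p"
proof -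
  have pow: "d dvd g i ^ k - g' i ^ k" for i k
    by (induction k) (simp_all add: assms dvd_diff_mult)
  have "d dvd (\<Prod>i\<in>S. g i ^ f i) - (\<Prod>i\<in>S. g' i ^ f i)" for S and f :: "nat \<Rightarrow> nat"
    by (induction S rule: infinite_finite_induct) (simp_all add: pow dvd_diff_mult)
  then have "d dvd h (Poly_Mapping.lookup p m) * monom_value g m -
      h (Poly_Mapping.lookup p m) * monom_value g' m" for m
    by (simp add: monom_value_def flip: right_diff_distrib)
  then show ?thesis
    by (simp add: mpoly_subst_def dvd_sum flip: sum_subtractf)
qed

section \<open>Polynomials in a given set of variables\<close>

lemma carrier_poly_ring: "carrier (poly_ring n) = mpolys {0..n}"
  by (simp add: poly_ring_def mpolys_def)

lemma mpolys_add: "p \<in> mpolys X \<Longrightarrow> q \<in> mpolys X \<Longrightarrow> p + q \<in> mpolys X"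
  using Poly_Mapping.keys_add[of p q] by (auto simp: mpolys_def)

lemma mpolys_mult:
  assumes "p \<in> mpolys X" "q \<in> mpolys X"
  shows "p * q \<in> mpolys X"
  unfolding mpolys_def
proof clarify
  fix m i assume "m \<in> Poly_Mapping.keys (p * q)" and i: "i \<in> Poly_Mapping.keys m"
  then obtain a b where "m = a + b" "a \<in> Poly_Mapping.keys p" "b \<in> Poly_Mapping.keys q"
    using keys_mult[of p q] by blast
  then show "i \<in> X"
    using assms i Poly_Mapping.keys_add[of a b] unfolding mpolys_def by blast
qed

lemma mpolys_const [simp]: "const c \<in> mpolys X"
  and mpolys_0 [simp]: "0 \<in> mpolys X"
  and mpolys_1 [simp]: "1 \<in> mpolys X"
  by (simp_all add: mpolys_def const_def)

lemma mpolys_var: "i \<in> X \<Longrightarrow> var i \<in> mpolys X"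
  by (simp add: mpolys_def var_def)

lemma mpolys_sum: "(\<And>x. x \<in> S \<Longrightarrow> f x \<in> mpolys X) \<Longrightarrow> (\<Sum>x\<in>S. f x) \<in> mpolys X"
  by (induction S rule: infinite_finite_induct) (simp_all add: mpolys_add)

lemma mpolys_power: "p \<in> mpolys X \<Longrightarrow> p ^ k \<in> mpolys X"
  by (induction k) (simp_all add: mpolys_mult)

lemma mpolys_prod: "(\<And>x. x \<in> S \<Longrightarrow> f x \<in> mpolys X) \<Longrightarrow> (\<Prod>x\<in>S. f x) \<in> mpolys X"
  by (induction S rule: infinite_finite_induct) (simp_all add: mpolys_mult)

lemma mpolys_subst:
  assumes "p \<in> mpolys X" "\<And>i. i \<in> X \<Longrightarrow> g i \<in> mpolys Y"
  shows "mpoly_subst const g p \<in> mpolys Y"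
  unfolding mpoly_subst_def monom_value_def
proof (intro mpolys_sum mpolys_mult mpolys_const mpolys_prod mpolys_power)
  fix m i assume "m \<in> Poly_Mapping.keys p" "i \<in> Poly_Mapping.keys m"
  then have "i \<in> X"
    using assms(1) by (auto simp: mpolys_def)
  then show "g i \<in> mpolys Y"
    by (rule assms(2))
qed

interpretation const: field_hom const
  by (rule field_hom.intro) (rule unital_hom_const)

interpretation const_pCons: field_hom "\<lambda>c. [:const c:]"
  by (rule field_hom.intro) (rule unital_hom_comp_const_pCons)

interpretation ident: field_hom "\<lambda>c. c :: 'k::field"
  by unfold_locales simp_all

text \<open>Setting the variables outside \<open>X\<close> to zero fixes both \<open>l\<close> and
  \<open>l * p\<close>. Cancelling \<open>l\<close> shows that it fixes \<open>p\<close> as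
  well.\<close>

lemma mpolys_cancel:
  fixes l p :: "'k::field mpoly"
  assumes "l \<in> mpolys X" "l \<noteq> 0" "l * p \<in> mpolys X"
  shows "p \<in> mpolys X"
proof -
  define e :: "nat \<Rightarrow> 'k mpoly" where "e = (\<lambda>i. if i \<in> X then var i else 0)"
  have fix_e: "mpoly_subst const e q = q" if "q \<in> mpolys X" for q
    using mpoly_subst_cong[OF that, of e var const] by (simp add: e_def)
  have "l * mpoly_subst const e p = l * p"
    using fix_e[OF assms(1)] fix_e[OF assms(3)] by (simp add: const.mpoly_subst_mult)
  then have "p = mpoly_subst const e p"
    using assms(2) by simp
  also have "\<dots> \<in> mpolys X"
    by (rule mpolys_subst[of _ UNIV]) (simp_all add: e_def mpolys_var, simp add: mpolys_def)
  finally show ?thesis .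
qed

section \<open>Order of vanishing\<close>

text \<open>\<open>F(p + u x)\<close> as a polynomial in \<open>u\<close>.\<close>

definition expand_at :: "(nat \<Rightarrow> 'k::field) \<Rightarrow> 'k mpoly \<Rightarrow> 'k mpoly poly" where
  "expand_at p = mpoly_subst (\<lambda>c. [:const c:]) (\<lambda>i. [:const (p i), var i:])"

lemma unital_hom_expand_at: "unital_hom (expand_at p)"
  unfolding expand_at_def by (rule const_pCons.unital_hom_mpoly_subst)

interpretation expand_at: unital_hom "expand_at p"
  by (rule unital_hom_expand_at)

lemma unital_hom_coeff_0: "unital_hom (\<lambda>q :: 'r::comm_ring_1 poly. coeff q 0)"
  by unfold_locales (simp_all add: coeff_mult)

lemma coeff_0_expand_at: "coeff (expand_at p F) 0 = const (eval_mpoly p F)"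
  unfolding expand_at_def eval_mpoly_eq_subst
  by (simp add: unital_hom.hom_mpoly_subst[OF unital_hom_coeff_0] const.hom_mpoly_subst)

lemma monom_value_shift:
  "monom_value (\<lambda>i. [:0, var i:]) m = Polynomial.monom (monom_value var m) (monom_degree m)"
proof -
  have pow: "[:0, var i :: 'a mpoly:] ^ k = Polynomial.monom (var i ^ k) k" for i k
    by (induction k) (simp_all add: monom_Suc mult.commute one_pCons monom_0 smult_monom)
  have "(\<Prod>i\<in>S. Polynomial.monom (g i) (f i)) = Polynomial.monom (\<Prod>i\<in>S. g i) (\<Sum>i\<in>S. f i)"
    for S and g :: "nat \<Rightarrow> 'a mpoly" and f
    by (induction S rule: infinite_finite_induct) (simp_all add: mult_monom)
  then show ?thesis
    by (simp add: monom_value_def pow monom_degree_def)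
qed

text \<open>At the origin the expansion is \<open>F(u x)\<close>, so its coefficient at
  \<open>u^k\<close> is the homogeneous component of degree \<open>k\<close>.\<close>

lemma lookup_coeff_expand_at_0:
  "Poly_Mapping.lookup (coeff (expand_at (\<lambda>_. 0) F) k) m =
     (if monom_degree m = k then Poly_Mapping.lookup F m else 0)"
proof -
  have "coeff (expand_at (\<lambda>_. 0) F) k =
      (\<Sum>m\<in>Poly_Mapping.keys F. if monom_degree m = k then Poly_Mapping.single m (Poly_Mapping.lookup F m) else 0)"
    unfolding expand_at_def mpoly_subst_def coeff_sum
    by (intro sum.cong)
       (auto simp: monom_value_shift smult_monom coeff_monom monom_value_var const_def mult_single)
  moreover have "Poly_Mapping.lookup (if monom_degree x = k
        then Poly_Mapping.single x (Poly_Mapping.lookup F x) else 0) m =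
      (if x = m then if monom_degree m = k then Poly_Mapping.lookup F m else 0 else 0)" for x
    by (simp add: lookup_single when_def)
  ultimately show ?thesis
    by (simp add: lookup_sum sum.delta' in_keys_iff)
qed

text \<open>Homogeneity becomes the identity \<open>F(u x) = u^d F(x)\<close>, which makes products,
  quotients and restrictions of forms easy to treat.\<close>

lemma homogeneous_iff_expand_at_0:
  "homogeneous d F \<longleftrightarrow> expand_at (\<lambda>_. 0) F = Polynomial.monom F d"
proof
  assume *: "homogeneous d F"
  show "expand_at (\<lambda>_. 0) F = Polynomial.monom F d"
    using * by (intro poly_eqI poly_mapping_eqI)
       (auto simp: lookup_coeff_expand_at_0 coeff_monom homogeneous_def in_keys_iff)
next
  assume *: "expand_at (\<lambda>_. 0) F = Polynomial.monom F d"
  show "homogeneous d F"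
    unfolding homogeneous_def
  proof
    fix m assume "m \<in> Poly_Mapping.keys F"
    moreover have "Poly_Mapping.lookup F m = (if monom_degree m = d then Poly_Mapping.lookup F m else 0)"
      using lookup_coeff_expand_at_0[of F d m] * by simp
    ultimately show "monom_degree m = d"
      by (auto simp: in_keys_iff split: if_splits)
  qed
qed

section \<open>Linear forms under substitution\<close>

lemma monom_degree_eq_1_iff: "monom_degree m = 1 \<longleftrightarrow> (\<exists>i. m = Poly_Mapping.single i 1)"
proof
  assume deg: "monom_degree m = 1"
  then obtain i where i: "i \<in> Poly_Mapping.keys m"
    by (force simp: monom_degree_def)
  have "monom_degree m = Poly_Mapping.lookup m i + (\<Sum>j\<in>Poly_Mapping.keys m - {i}. Poly_Mapping.lookup m j)"
    unfolding monom_degree_def using i by (simp add: sum.remove)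
  moreover have "0 < Poly_Mapping.lookup m i"
    using i by (simp add: in_keys_iff)
  ultimately have one: "Poly_Mapping.lookup m i = 1"
    and zero: "(\<Sum>j\<in>Poly_Mapping.keys m - {i}. Poly_Mapping.lookup m j) = 0"
    using deg by arith+
  have "\<forall>j\<in>Poly_Mapping.keys m - {i}. Poly_Mapping.lookup m j = 0"
    using zero by (simp only: sum_eq_0_iff finite_Diff finite_keys)
  then have "Poly_Mapping.lookup m k = 0" if "k \<noteq> i" for k
    using that by (metis Diff_iff in_keys_iff singletonD)
  then have "Poly_Mapping.lookup m k = Poly_Mapping.lookup (Poly_Mapping.single i 1) k" for k
    using one by (cases "k = i") (simp_all add: lookup_single when_def)
  then have "m = Poly_Mapping.single i 1"
    by (rule poly_mapping_eqI)
  then show "\<exists>i. m = Poly_Mapping.single i 1" ..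
qed (auto simp: monom_degree_def)

lemma homogeneous_1_subst_add:
  assumes "homogeneous 1 l"
  shows "mpoly_subst h (\<lambda>i. g i + g' i) l = mpoly_subst h g l + mpoly_subst h g' l"
  unfolding mpoly_subst_def sum.distrib[symmetric]
proof (rule sum.cong)
  fix m assume "m \<in> Poly_Mapping.keys l"
  then obtain i where "m = Poly_Mapping.single i 1"
    using assms by (auto simp: homogeneous_def monom_degree_eq_1_iff[unfolded One_nat_def])
  then show "h (Poly_Mapping.lookup l m) * monom_value (\<lambda>i. g i + g' i) m =
      h (Poly_Mapping.lookup l m) * monom_value g m + h (Poly_Mapping.lookup l m) * monom_value g' m"
    by (simp only: monom_value_single distrib_left)
qed simp

lemma homogeneous_1_subst_scale:
  assumes "homogeneous 1 l"
  shows "mpoly_subst h (\<lambda>i. c * g i) l = c * mpoly_subst h g l"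
  unfolding mpoly_subst_def sum_distrib_left
proof (rule sum.cong)
  fix m assume "m \<in> Poly_Mapping.keys l"
  then obtain i where "m = Poly_Mapping.single i 1"
    using assms by (auto simp: homogeneous_def monom_degree_eq_1_iff[unfolded One_nat_def])
  then show "h (Poly_Mapping.lookup l m) * monom_value (\<lambda>i. c * g i) m =
      c * (h (Poly_Mapping.lookup l m) * monom_value g m)"
    by (simp only: monom_value_single mult_ac)
qed simp

lemma homogeneous_1_subst_delta:
  assumes "homogeneous 1 l" "h 0 = 0"
  shows "mpoly_subst h (\<lambda>i. if i = j then c else 0) l = h (Poly_Mapping.lookup l (Poly_Mapping.single j 1)) * c"
proof -
  have "h (Poly_Mapping.lookup l m) * monom_value (\<lambda>i. if i = j then c else 0) m =
      (if m = Poly_Mapping.single j 1 then h (Poly_Mapping.lookup l m) * c else 0)"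
    if m: "m \<in> Poly_Mapping.keys l" for m
  proof -
    obtain i where "m = Poly_Mapping.single i 1"
      using m assms(1) by (auto simp: homogeneous_def monom_degree_eq_1_iff[unfolded One_nat_def])
    moreover have "Poly_Mapping.single i (1::nat) = Poly_Mapping.single j 1 \<longleftrightarrow> i = j"
      by (metis lookup_single_eq lookup_single_not_eq zero_neq_one)
    ultimately show ?thesis
      by (simp only: monom_value_single) simp
  qed
  then have "mpoly_subst h (\<lambda>i. if i = j then c else 0) l =
      (\<Sum>m\<in>Poly_Mapping.keys l. if m = Poly_Mapping.single j 1 then h (Poly_Mapping.lookup l m) * c else 0)"
    unfolding mpoly_subst_def by (intro sum.cong) auto
  then show ?thesis
    using assms(2) by (simp add: sum.delta in_keys_iff)
qed

text \<open>By linearity \<open>l(p + u x) = l(p) + u l(x)\<close>. Hence a factor \<open>l\<close>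
  contributes one power of \<open>u\<close> if \<open>l(p) = 0\<close>, and none otherwise.\<close>

lemma expand_at_homogeneous_1:
  assumes "homogeneous 1 l"
  shows "expand_at p l = [:const (eval_mpoly p l), l:]"
proof -
  have "expand_at p l = mpoly_subst (\<lambda>c. [:const c:]) (\<lambda>i. [:const (p i):] + [:0, 1:] * [:var i:]) l"
    by (simp add: expand_at_def)
  also have "\<dots> = mpoly_subst (\<lambda>c. [:const c:]) (\<lambda>i. [:const (p i):]) l
      + [:0, 1:] * mpoly_subst (\<lambda>c. [:const c:]) (\<lambda>i. [:var i:]) l"
    using assms by (simp only: homogeneous_1_subst_add homogeneous_1_subst_scale)
  also have "mpoly_subst (\<lambda>c. [:const c:]) (\<lambda>i. [:const (p i):]) l = [:const (eval_mpoly p l):]"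
    by (simp add: eval_mpoly_eq_subst const_pCons.hom_mpoly_subst)
  also have "mpoly_subst (\<lambda>c. [:const c:]) (\<lambda>i. [:var i:]) l = [:l:]"
  proof -
    interpret c: unital_hom "\<lambda>q::'a mpoly. [:q:]"
      by unfold_locales (simp_all add: one_pCons)
    show ?thesis
      using c.hom_mpoly_subst[of const var l] by simp
  qed
  finally show ?thesis
    by simp
qed

section \<open>Elimination of a variable\<close>

text \<open>The substitution \<open>x\<^sub>j \<mapsto> x\<^sub>j - l / a\<^sub>j\<close> with \<open>a\<^sub>j\<close> the coefficient of \<open>x\<^sub>j\<close> in \<open>l\<close>
  restricts polynomials to the hyperplane \<open>l = 0\<close>.\<close>

locale elimination =
  fixes l :: "'k::field mpoly" and j :: nat
  assumes homogeneous_l: "homogeneous 1 l"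
    and coeff_j: "Poly_Mapping.lookup l (Poly_Mapping.single j 1) \<noteq> 0"
begin

definition inv_coeff :: 'k where
  "inv_coeff = inverse (Poly_Mapping.lookup l (Poly_Mapping.single j 1))"

text \<open>Each image is \<open>var i\<close> plus a correction, so that linearity applies to
  \<open>elim l\<close> and every correction is visibly a multiple of \<open>l\<close>.\<close>

definition elim :: "'k mpoly \<Rightarrow> 'k mpoly" where
  "elim = mpoly_subst const (\<lambda>i. var i + (if i = j then - const inv_coeff * l else 0))"

lemma unital_hom_elim: "unital_hom elim"
  unfolding elim_def by (rule const.unital_hom_mpoly_subst)

sublocale elim: unital_hom elim
  by (rule unital_hom_elim)

lemma elim_l [simp]: "elim l = 0"
proof -
  have "elim l = l + const (Poly_Mapping.lookup l (Poly_Mapping.single j 1)) * (- const inv_coeff * l)"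
    unfolding elim_def using homogeneous_l
    by (simp only: homogeneous_1_subst_add homogeneous_1_subst_delta const_0 mpoly_subst_var)
  also have "\<dots> = l - const (Poly_Mapping.lookup l (Poly_Mapping.single j 1) * inv_coeff) * l"
    by (simp add: const.hom_mult)
  finally show ?thesis
    using coeff_j by (simp add: inv_coeff_def)
qed

lemma dvd_diff_elim: "l dvd F - elim F"
proof -
  have "l dvd mpoly_subst const var F - elim F"
    unfolding elim_def by (rule dvd_diff_mpoly_subst) simp
  then show ?thesis
    by simp
qed

text \<open>\<open>F\<close> and \<open>elim F\<close> are congruent modulo \<open>l\<close>.
  Consequently a polynomial not divisible by \<open>l\<close> has nonzero restriction.\<close>

lemma elim_eq_0D: "elim F = 0 \<Longrightarrow> l dvd F"
  using dvd_diff_elim[of F] by simp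

lemma elim_mpolys:
  assumes "l \<in> mpolys X" "F \<in> mpolys X"
  shows "elim F \<in> mpolys (X - {j})"
  unfolding elim_def
proof (rule mpolys_subst[OF assms(2)])
  fix i assume "i \<in> X"
  show "var i + (if i = j then - const inv_coeff * l else 0) \<in> mpolys (X - {j})"
  proof (cases "i = j")
    case True
    have "Poly_Mapping.keys m \<subseteq> X - {j}"
      if m: "m \<in> Poly_Mapping.keys (var j + - const inv_coeff * l)" for m
    proof -
      \<comment> \<open>At the monomial \<open>x_j\<close> the two terms cancel by the choice of
        \<open>inv_coeff\<close>; only the other variables of \<open>l\<close> survive.\<close>
      have eq: "Poly_Mapping.lookup (var j + - const inv_coeff * l) m =
          (1 when m = Poly_Mapping.single j 1) - inv_coeff * Poly_Mapping.lookup l m" for m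
        by (simp add: lookup_add lookup_minus lookup_const_mult var_def lookup_single when_def)
      have ne: "m \<noteq> Poly_Mapping.single j 1"
        using m coeff_j eq[of m] by (auto simp: in_keys_iff inv_coeff_def)
      then have l: "m \<in> Poly_Mapping.keys l"
        using m eq[of m] by (auto simp: in_keys_iff)
      then obtain i where i: "m = Poly_Mapping.single i 1"
        using homogeneous_l by (auto simp: homogeneous_def monom_degree_eq_1_iff[unfolded One_nat_def])
      moreover have "Poly_Mapping.keys m \<subseteq> X"
        using l assms(1) by (auto simp: mpolys_def)
      ultimately show ?thesis
        using ne by auto
    qed
    then show ?thesis
      using True by (simp add: mpolys_def)
  qed (use \<open>i \<in> X\<close> in \<open>simp add: mpolys_var\<close>)
qed

text \<open>Both sides are substitutions into \<open>F\<close>, so constants and variables suffice.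
  Since \<open>l(p) = 0\<close>, the expansion of \<open>l\<close> is \<open>u l\<close>, and the
  correction touches only the coefficient of \<open>u\<close>. Thus restriction to a hyperplane
  through \<open>p\<close> preserves vanishing to a given order at \<open>p\<close>.\<close>

lemma expand_at_elim:
  assumes "eval_mpoly p l = 0"
  shows "expand_at p (elim F) = map_poly elim (expand_at p F)"
proof -
  interpret map_elim: unital_hom "map_poly elim"
    by (rule elim.unital_hom_map_poly)
  have elim_const: "elim (const c) = const c" for c
    by (simp add: elim_def)
  have elim_var: "elim (var i) = var i + (if i = j then - const inv_coeff * l else 0)" for i
    by (simp add: elim_def)
  have "expand_at p (elim F) = mpoly_subst (\<lambda>c. expand_at p (const c))
      (\<lambda>i. expand_at p (var i + (if i = j then - const inv_coeff * l else 0))) F"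
    unfolding elim_def by (rule expand_at.hom_mpoly_subst)
  also have "\<dots> = mpoly_subst (\<lambda>c. map_poly elim [:const c:])
      (\<lambda>i. map_poly elim [:const (p i), var i:]) F"
  proof (rule arg_cong2[of _ _ _ _ "\<lambda>h g. mpoly_subst h g F"])
    show "(\<lambda>c. expand_at p (const c)) = (\<lambda>c. map_poly elim [:const c:])"
      by (simp add: fun_eq_iff expand_at_def map_poly_pCons elim.hom_zero elim_const)
    have "expand_at p (var i) = [:const (p i), var i:]" "expand_at p (const c) = [:const c:]" for i c
      by (simp_all add: expand_at_def)
    then have "expand_at p (var i + (if i = j then - const inv_coeff * l else 0)) = [:const (p i), elim (var i):]" for i
      using assms
      by (simp add: elim_var expand_at.hom_add expand_at.hom_mult expand_at.hom_uminus expand_at.hom_zero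
          expand_at_homogeneous_1[OF homogeneous_l])
    then show "(\<lambda>i. expand_at p (var i + (if i = j then - const inv_coeff * l else 0))) =
        (\<lambda>i. map_poly elim [:const (p i), var i:])"
      by (simp add: map_poly_pCons elim.hom_zero elim_const)
  qed
  also have "\<dots> = map_poly elim (expand_at p F)"
    unfolding expand_at_def by (rule map_elim.hom_mpoly_subst[symmetric])
  finally show ?thesis .
qed

lemma elim_homogeneous:
  assumes "homogeneous d F"
  shows "homogeneous d (elim F)"
proof -
  \<comment> \<open>The origin lies on \<open>l = 0\<close>, so homogeneity is preserved by the case
    \<open>p = 0\<close> of \<open>expand_at_elim\<close>.\<close>
  have "coeff (expand_at (\<lambda>_. 0) l) 0 = 0"
    using homogeneous_l by (simp add: homogeneous_iff_expand_at_0)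
  then have "eval_mpoly (\<lambda>_. 0) l = 0"
    by (metis coeff_0_expand_at const_def lookup_single_eq lookup_zero)
  with assms show ?thesis
    by (simp add: homogeneous_iff_expand_at_0 expand_at_elim map_poly_monom elim.hom_zero)
qed

lemma eval_elim:
  assumes "eval_mpoly p l = 0"
  shows "eval_mpoly p (elim F) = eval_mpoly p F"
proof -
  interpret eval: unital_hom "eval_mpoly p"
    unfolding eval_mpoly_eq_subst by (rule ident.unital_hom_mpoly_subst)
  have "eval_mpoly p l dvd eval_mpoly p (F - elim F)"
    by (rule eval.hom_dvd[OF dvd_diff_elim])
  then show ?thesis
    using assms by (simp add: eval.hom_diff)
qed

end

text \<open>Multiplicity at least \<open>m\<close>, expressed without derivatives and therefore
  correct in every characteristic.\<close>

definition vanishes_at :: "(nat \<Rightarrow> 'k::field) \<Rightarrow> nat \<Rightarrow> 'k mpoly \<Rightarrow> bool" where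
  "vanishes_at p m F \<longleftrightarrow> Polynomial.monom 1 m dvd expand_at p F"

lemma vanishes_at_iff: "vanishes_at p m F \<longleftrightarrow> (\<forall>k<m. coeff (expand_at p F) k = 0)"
  by (simp add: vanishes_at_def monom_1_dvd_iff')

section \<open>Cancelling a linear form\<close>

lemma const_eq_0_iff [simp]: "const c = 0 \<longleftrightarrow> c = 0"
  by (metis const_0 const_def lookup_single_eq lookup_zero)

text \<open>With \<open>F_k\<close> the coefficient of \<open>u^k\<close> in the expansion of
  \<open>F\<close>, that of \<open>l F\<close> is \<open>l(p) F_k + l F_(k-1)\<close>. Induction on
  \<open>k\<close> kills the second summand, and \<open>l(p)\<close> is a nonzero constant.\<close>

lemma vanishes_at_cancel_nonzero:
  fixes l :: "'k::field mpoly"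
  assumes "homogeneous 1 l" "eval_mpoly p l \<noteq> 0" "vanishes_at p m (l * F)"
  shows "vanishes_at p m F"
  unfolding vanishes_at_iff
proof (intro allI impI)
  fix k assume "k < m"
  then show "coeff (expand_at p F) k = 0"
  proof (induction k rule: less_induct)
    case (less k)
    have "coeff (expand_at p (l * F)) k = 0"
      using less.prems assms(3) by (simp add: vanishes_at_iff)
    moreover have "coeff (pCons 0 (smult l (expand_at p F))) k = 0"
      using less by (cases k) auto
    ultimately have "const (eval_mpoly p l) * coeff (expand_at p F) k = 0"
      by (simp add: expand_at.hom_mult expand_at_homogeneous_1[OF assms(1)])
    then show ?case
      using assms(2) by simp
  qed
qed

text \<open>Here \<open>l F\<close> expands to \<open>u l\<close> times the expansion of
  \<open>F\<close>, so cancelling \<open>l\<close> costs one order.\<close>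

lemma vanishes_at_cancel_zero:
  fixes l :: "'k::field mpoly"
  assumes "homogeneous 1 l" "eval_mpoly p l = 0" "l \<noteq> 0" "vanishes_at p m (l * F)"
  shows "vanishes_at p (m - 1) F"
  unfolding vanishes_at_iff
proof (intro allI impI)
  fix k assume "k < m - 1"
  then have "coeff (expand_at p (l * F)) (Suc k) = 0"
    using assms(4) by (simp add: vanishes_at_iff)
  then show "coeff (expand_at p F) k = 0"
    using assms(2,3) by (simp add: expand_at.hom_mult expand_at_homogeneous_1[OF assms(1)])
qed

text \<open>Compare \<open>u l F(u x)\<close> with \<open>u^d l F\<close>: the left side has no
  constant term in \<open>u\<close>, so \<open>d > 0\<close>, and \<open>u l\<close> can be
  cancelled.\<close>

lemma homogeneous_cancel:
  fixes l F :: "'k::field mpoly"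
  assumes "homogeneous 1 l" "l \<noteq> 0" "F \<noteq> 0" "homogeneous d (l * F)"
  obtains d' where "d = Suc d'" "homogeneous d' F"
proof -
  have *: "Polynomial.monom l 1 * expand_at (\<lambda>_. 0) F = Polynomial.monom (l * F) d"
    using assms(1,4) by (simp add: homogeneous_iff_expand_at_0 expand_at.hom_mult)
  have "d \<noteq> 0"
  proof
    assume "d = 0"
    then have "coeff (Polynomial.monom l 1 * expand_at (\<lambda>_. 0) F) 0 = l * F"
      using * by simp
    then show False
      using assms(2,3) by (simp add: coeff_monom_mult)
  qed
  then obtain d' where d: "d = Suc d'"
    using not0_implies_Suc by blast
  moreover have "Polynomial.monom l 1 * expand_at (\<lambda>_. 0) F = Polynomial.monom l 1 * Polynomial.monom F d'"
    using * d by (simp add: mult_monom)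
  ultimately show ?thesis
    using assms(2) that by (simp add: homogeneous_iff_expand_at_0 monom_eq_0_iff)
qed

section \<open>Forms in a single variable\<close>

lemma homogeneous_one_variable:
  assumes "F \<in> mpolys {x}" "homogeneous d F"
  obtains c where "F = const c * var x ^ d"
proof -
  have keys: "m = Poly_Mapping.single x d" if m: "m \<in> Poly_Mapping.keys F" for m
  proof (rule poly_mapping_eqI)
    fix i
    have sub: "Poly_Mapping.keys m \<subseteq> {x}"
      using m assms(1) by (auto simp: mpolys_def)
    then have "(\<Sum>i\<in>Poly_Mapping.keys m. Poly_Mapping.lookup m i) = (\<Sum>i\<in>{x}. Poly_Mapping.lookup m i)"
      by (intro sum.mono_neutral_left) (auto simp: in_keys_iff)
    then have "Poly_Mapping.lookup m x = d"
      using m assms(2) by (auto simp: homogeneous_def monom_degree_def)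
    then show "Poly_Mapping.lookup m i = Poly_Mapping.lookup (Poly_Mapping.single x d) i"
      using sub by (cases "i = x") (auto simp: lookup_single when_def in_keys_iff)
  qed
  have pow: "var x ^ d = (Poly_Mapping.single (Poly_Mapping.single x d) 1 :: 'a mpoly)"
    by (induction d) (simp_all add: single_one var_def mult_single flip: single_add)
  have "F = Poly_Mapping.single (Poly_Mapping.single x d) (Poly_Mapping.lookup F (Poly_Mapping.single x d))"
    using keys by (intro poly_mapping_eqI) (auto simp: lookup_single when_def in_keys_iff)
  then have "F = const (Poly_Mapping.lookup F (Poly_Mapping.single x d)) * var x ^ d"
    by (simp add: pow const_def mult_single)
  then show ?thesis
    by (rule that)
qed

lemma unital_hom_eval: "unital_hom (eval_mpoly p)"
  unfolding eval_mpoly_eq_subst by (rule ident.unital_hom_mpoly_subst)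

interpretation eval: unital_hom "eval_mpoly p"
  by (rule unital_hom_eval)

lemma eval_const [simp]: "eval_mpoly p (const c) = c"
  and eval_var [simp]: "eval_mpoly p (var i) = p i"
  by (simp_all add: eval_mpoly_eq_subst)

text \<open>The form \<open>l\<close> certifies that the coordinate \<open>p x\<close> is nonzero;
  then \<open>c x^d\<close> with \<open>c\<close> nonzero cannot vanish at \<open>p\<close>.\<close>

lemma vanishes_at_one_variable:
  assumes "F \<in> mpolys {x}" "homogeneous d F" "F \<noteq> 0"
    and "l \<in> mpolys {x}" "homogeneous 1 l" "eval_mpoly p l \<noteq> 0"
    and "vanishes_at p m F"
  shows "m = 0"
proof (rule ccontr)
  assume "m \<noteq> 0"
  then have "eval_mpoly p F = 0"
    using assms(7) coeff_0_expand_at[of p F] by (simp add: vanishes_at_iff)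
  moreover obtain c where F: "F = const c * var x ^ d"
    using homogeneous_one_variable[OF assms(1,2)] .
  moreover obtain c' where "l = const c' * var x ^ 1"
    using homogeneous_one_variable[OF assms(4,5)] .
  ultimately show False
    using assms(3,6) by (auto simp: eval.hom_mult eval.hom_power)
qed

section \<open>Degree bounds for arrangements\<close>

text \<open>The linear forms \<open>l j\<close> live in \<open>n + 1\<close> variables \<open>X\<close>; the vector \<open>p \<sigma>\<close>
  represents the point where the hyperplanes indexed by \<open>\<sigma>\<close> meet.\<close>

locale arrangement =
  fixes X V :: "nat set" and n :: nat and l :: "nat \<Rightarrow> 'k::field mpoly"
    and p :: "nat set \<Rightarrow> nat \<Rightarrow> 'k"
  assumes finite_X: "finite X" and card_X: "card X = Suc n"
    and finite_V: "finite V" and card_V: "n < card V"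
    and l_mpolys: "\<And>j. j \<in> V \<Longrightarrow> l j \<in> mpolys X"
    and l_homogeneous: "\<And>j. j \<in> V \<Longrightarrow> homogeneous 1 (l j)"
    and eval_l: "\<And>\<sigma> j. \<sigma> \<in> nsets V n \<Longrightarrow> j \<in> V \<Longrightarrow> eval_mpoly (p \<sigma>) (l j) = 0 \<longleftrightarrow> j \<in> \<sigma>"
begin

text \<open>As \<open>n < card V\<close>, some \<sigma> avoids \<open>j\<close>, and
  \<open>l j\<close> does not vanish at its point.\<close>

lemma l_nonzero:
  assumes "j \<in> V"
  shows "l j \<noteq> 0"
proof
  assume "l j = 0"
  obtain \<sigma> where "\<sigma> \<subseteq> V - {j}" "card \<sigma> = n" "finite \<sigma>"
  proof (rule obtain_subset_with_card_n)
    show "n \<le> card (V - {j})"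
      using card_V finite_V assms by simp
  qed
  then have "\<sigma> \<in> nsets V n" "j \<notin> \<sigma>"
    by (auto simp: nsets_def)
  with eval_l[of \<sigma> j] assms \<open>l j = 0\<close> show False
    by (simp add: eval.hom_zero)
qed

text \<open>Dividing by \<open>l j\<close> lowers the degree by one and raises the weight of
  \<open>j\<close> by one. The guaranteed order at the point of \<sigma> drops by one exactly when
  \<open>j\<close> lies in \<sigma>, in step with \<open>sum w \<sigma>\<close> (truncated at
  zero).\<close>

lemma divide_out:
  assumes "C \<subseteq> nsets V n" "F \<noteq> 0" "F \<in> mpolys X" "homogeneous d F"
    and "\<forall>\<sigma>\<in>C. vanishes_at (p \<sigma>) (m - sum w \<sigma>) F"
  shows "\<exists>F' d' w'. F' \<noteq> 0 \<and> F' \<in> mpolys X \<and> homogeneous d' F' \<and>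
    (\<forall>\<sigma>\<in>C. vanishes_at (p \<sigma>) (m - sum w' \<sigma>) F') \<and>
    (\<forall>j\<in>V. \<not> l j dvd F') \<and> d' + sum w' V = d + sum w V"
  using assms(2-)
proof (induction d arbitrary: F w rule: less_induct)
  case (less d)
  show ?case
  proof (cases "\<exists>j\<in>V. l j dvd F")
    case False
    then show ?thesis
      using less.prems by (intro exI[of _ F] exI[of _ d] exI[of _ w]) auto
  next
    case True
    then obtain j G where j: "j \<in> V" and F: "F = l j * G"
      by (auto simp: dvd_def)
    have G: "G \<noteq> 0"
      using less.prems(1) F by auto
    obtain d' where d: "d = Suc d'" and hom: "homogeneous d' G"
      using homogeneous_cancel[OF l_homogeneous[OF j] l_nonzero[OF j] G] less.prems(3) F by metis
    define w' where "w' = w(j := Suc (w j))"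
    have sum_w': "sum w' A = sum w A + (if j \<in> A then 1 else 0)" if "finite A" for A
    proof (cases "j \<in> A")
      case True
      have "sum w' (A - {j}) = sum w (A - {j})"
        by (rule sum.cong) (auto simp: w'_def)
      then show ?thesis
        using that True by (simp add: sum.remove[of A j] w'_def)
    next
      case False
      then show ?thesis
        by (auto simp: w'_def intro!: sum.cong)
    qed
    have "\<exists>F' d'' w''. F' \<noteq> 0 \<and> F' \<in> mpolys X \<and> homogeneous d'' F' \<and>
        (\<forall>\<sigma>\<in>C. vanishes_at (p \<sigma>) (m - sum w'' \<sigma>) F') \<and>
        (\<forall>j\<in>V. \<not> l j dvd F') \<and> d'' + sum w'' V = d' + sum w' V"
    proof (rule less.IH)
      show "d' < d" "G \<noteq> 0" "homogeneous d' G"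
        using d G hom by simp_all
      show "G \<in> mpolys X"
        using mpolys_cancel[OF l_mpolys[OF j] l_nonzero[OF j]] less.prems(2) F by simp
      show "\<forall>\<sigma>\<in>C. vanishes_at (p \<sigma>) (m - sum w' \<sigma>) G"
      proof
        fix \<sigma> assume \<sigma>: "\<sigma> \<in> C"
        show "vanishes_at (p \<sigma>) (m - sum w' \<sigma>) G"
        proof (cases "j \<in> \<sigma>")
          case True
          then have "eval_mpoly (p \<sigma>) (l j) = 0"
            using eval_l[of \<sigma> j] \<sigma> assms(1) j by auto
          moreover have "finite \<sigma>"
            using \<sigma> assms(1) by (auto simp: nsets_def)
          ultimately show ?thesis
            using vanishes_at_cancel_zero[OF l_homogeneous[OF j] _ l_nonzero[OF j],
                where p = "p \<sigma>" and m = "m - sum w \<sigma>" and F = G] bspec[OF less.prems(4) \<sigma>] F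
            by (simp add: sum_w' True)
        next
          case False
          then have "eval_mpoly (p \<sigma>) (l j) \<noteq> 0"
            using eval_l[of \<sigma> j] \<sigma> assms(1) j by auto
          moreover have "finite \<sigma>"
            using \<sigma> assms(1) by (auto simp: nsets_def)
          ultimately show ?thesis
            using vanishes_at_cancel_nonzero[OF l_homogeneous[OF j]] bspec[OF less.prems(4) \<sigma>] F
            by (simp add: sum_w' False)
        qed
      qed
    qed
    then show ?thesis
      using j d finite_V by (simp add: sum_w')
  qed
qed

lemma obtain_elimination:
  assumes "j \<in> V"
  obtains x where "x \<in> X" "elimination (l j) x"
proof -
  obtain m where m: "m \<in> Poly_Mapping.keys (l j)"
    using l_nonzero[OF assms] by (metis all_not_in_conv keys_eq_empty)
  then obtain x where x: "m = Poly_Mapping.single x 1"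
    using l_homogeneous[OF assms]
    by (auto simp: homogeneous_def monom_degree_eq_1_iff[unfolded One_nat_def])
  have "x \<in> X"
    using m x l_mpolys[OF assms] by (auto simp: mpolys_def)
  moreover have "elimination (l j) x"
    using m x l_homogeneous[OF assms] by unfold_locales (auto simp: in_keys_iff)
  ultimately show ?thesis
    by (rule that)
qed

text \<open>The points on the hyperplane of \<open>i\<close> are those whose index contains
  \<open>i\<close>; removing \<open>i\<close> from the index describes the trace of the other
  hyperplanes.\<close>

lemma arrangement_restrict:
  assumes "i \<in> V" "x \<in> X" "elimination (l i) x" "n = Suc k"
  shows "arrangement (X - {x}) (V - {i}) k (\<lambda>j. elimination.elim (l i) x (l j)) (\<lambda>\<sigma>. p (insert i \<sigma>))"
proof -
  interpret elimination "l i" x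
    by (rule assms(3))
  show ?thesis
  proof
    fix \<sigma> j assume \<sigma>: "\<sigma> \<in> nsets (V - {i}) k" and j: "j \<in> V - {i}"
    have "insert i \<sigma> \<in> nsets V n"
      using \<sigma> assms(1,4) by (auto simp: nsets_def card_insert_if)
    then show "eval_mpoly (p (insert i \<sigma>)) (elim (l j)) = 0 \<longleftrightarrow> j \<in> \<sigma>"
      using eval_l[of "insert i \<sigma>"] assms(1) j by (simp add: eval_elim)
  qed (use assms finite_X card_X finite_V card_V l_mpolys l_homogeneous in
        \<open>auto intro!: elim_mpolys elim_homogeneous\<close>)
qed

end

text \<open>Weights belong to the statement because the remaining forms keep theirs after
  restriction. With \<open>Suc n\<close> as dimension, the induction starts on the projective
  line.\<close>

theorem arrangement_degree_bound:
  fixes c :: real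
  assumes "arrangement X V (Suc n) l p" "C \<subseteq> nsets V (Suc n)"
    and "1 \<le> c" "c * real (Suc n) \<le> real (card V)"
    and "\<And>\<tau>. \<tau> \<in> nsets V n \<Longrightarrow> c \<le> real (card {\<sigma>\<in>C. \<tau> \<subseteq> \<sigma>})"
    and "F \<noteq> 0" "F \<in> mpolys X" "homogeneous d F"
    and "\<forall>\<sigma>\<in>C. vanishes_at (p \<sigma>) (m - sum w \<sigma>) F"
  shows "c * real m \<le> real (d + sum w V)"
  using assms(1,2,4-)
proof (induction n arbitrary: X V l p C F d m w)
  case 0
  interpret arrangement X V "Suc 0" l p
    by (rule 0)
  obtain F' d' w' where F': "F' \<noteq> 0" "F' \<in> mpolys X" "homogeneous d' F'"
    "\<forall>\<sigma>\<in>C. vanishes_at (p \<sigma>) (m - sum w' \<sigma>) F'"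
    "\<forall>j\<in>V. \<not> l j dvd F'" "d' + sum w' V = d + sum w V"
    using divide_out[OF 0(2) 0(5-8)] by (elim exE conjE) (rule that)
  \<comment> \<open>On a line the hyperplane of \<open>i\<close> is a point. The restricted quotient
    is a nonzero form in one variable, so no order of vanishing is left and the weight of
    \<open>i\<close> accounts for all of \<open>m\<close>.\<close>
  have w': "\<exists>i\<in>V. \<sigma> = {i} \<and> m \<le> w' i" if \<sigma>: "\<sigma> \<in> C" for \<sigma>
  proof -
    have "\<sigma> \<subseteq> V" "card \<sigma> = 1"
      using \<sigma> 0(2) by (auto simp: nsets_def)
    then obtain i where i: "i \<in> V" "\<sigma> = {i}"
      by (metis card_1_singletonE insert_subset)
    obtain x where x: "x \<in> X" "elimination (l i) x"
      using obtain_elimination[OF i(1)] .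
    interpret elimination "l i" x
      by (rule x(2))
    obtain y where y: "X - {x} = {y}"
      using x(1) card_X card_1_singletonE[of "X - {x}"] by auto
    \<comment> \<open>A second form, nonzero at this point, shows that the remaining coordinate is
      nonzero.\<close>
    obtain j where j: "j \<in> V" "j \<noteq> i"
    proof -
      have "card (V - {i}) \<noteq> 0"
        using card_V i(1) by simp
      then have "V - {i} \<noteq> {}"
        by (metis card.empty)
      then show ?thesis
        using that by blast
    qed
    have eval: "eval_mpoly (p \<sigma>) (l i) = 0" "eval_mpoly (p \<sigma>) (l j) \<noteq> 0"
      using eval_l[of \<sigma>] \<sigma> 0(2) i j by auto
    have "m - w' i = 0"
    proof (rule vanishes_at_one_variable)
      show "elim F' \<in> mpolys {y}" "elim (l j) \<in> mpolys {y}"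
        using elim_mpolys[OF l_mpolys[OF i(1)]] F'(2) l_mpolys[OF j(1)] y by auto
      show "homogeneous d' (elim F')" "homogeneous 1 (elim (l j))"
        using elim_homogeneous F'(3) l_homogeneous[OF j(1)] by auto
      show "elim F' \<noteq> 0"
        using elim_eq_0D F'(5) i(1) by blast
      show "eval_mpoly (p \<sigma>) (elim (l j)) \<noteq> 0"
        using eval by (simp add: eval_elim)
      have "vanishes_at (p \<sigma>) (m - w' i) F'"
        using F'(4) \<sigma> i(2) by auto
      then show "vanishes_at (p \<sigma>) (m - w' i) (elim F')"
        using eval(1) by (auto simp: vanishes_at_iff expand_at_elim coeff_map_poly elim.hom_zero)
    qed
    then show ?thesis
      using i by auto
  qed
  have "finite C"
    using 0(2) finite_V finite_imp_finite_nsets finite_subset by metis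
  define I where "I = {i\<in>V. m \<le> w' i}"
  have "finite I" "I \<subseteq> V"
    using finite_V by (auto simp: I_def)
  have "C \<subseteq> (\<lambda>i. {i}) ` I"
    using w' by (auto simp: I_def)
  then have "card C \<le> card I"
    using \<open>finite I\<close> by (meson card_image_le card_mono finite_imageI le_trans)
  \<comment> \<open>The empty set is the only \<tau> here, and every member of \<open>C\<close>
    contains it.\<close>
  have "c \<le> real (card C)"
    using 0(4)[of "{}"] by (simp add: nsets_def)
  then have "c * real m \<le> real (card C) * real m"
    by (intro mult_right_mono) auto
  also have "\<dots> \<le> real (card I * m)"
    using \<open>card C \<le> card I\<close> by (simp add: mult_right_mono)
  also have "card I * m = (\<Sum>i\<in>I. m)"
    by simp
  also have "\<dots> \<le> sum w' I"
    by (intro sum_mono) (auto simp: I_def)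
  also have "sum w' I \<le> sum w' V"
    using finite_V \<open>I \<subseteq> V\<close> by (intro sum_mono2) auto
  finally have "c * real m \<le> real (sum w' V)"
    by simp
  also have "\<dots> \<le> real (d + sum w V)"
    unfolding of_nat_le_iff using F'(6) by simp
  finally show ?case .
next
  case (Suc n)
  interpret arrangement X V "Suc (Suc n)" l p
    by (rule Suc.prems)
  obtain F' d' w' where F': "F' \<noteq> 0" "F' \<in> mpolys X" "homogeneous d' F'"
    "\<forall>\<sigma>\<in>C. vanishes_at (p \<sigma>) (m - sum w' \<sigma>) F'"
    "\<forall>j\<in>V. \<not> l j dvd F'" "d' + sum w' V = d + sum w V"
    using divide_out[OF Suc.prems(2,5-8)] by (elim exE conjE) (rule that)
  have "V \<noteq> {}"
    using card_V by auto
  then obtain i where i: "i \<in> V" and min: "\<And>j. j \<in> V \<Longrightarrow> w' i \<le> w' j"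
    using finite_V arg_min_if_finite(1) arg_min_least by metis
  \<comment> \<open>Subtracting the minimum gives \<open>u i = 0\<close>, so passing from
    \<open>V\<close> to \<open>V - {i}\<close> loses no weight.\<close>
  define u where "u = (\<lambda>j. w' j - w' i)"
  have sum_w': "sum w' A = sum u A + card A * w' i" if "A \<subseteq> V" for A
  proof -
    have "sum w' A = (\<Sum>j\<in>A. u j + w' i)"
      using min that by (intro sum.cong) (auto simp: u_def)
    then show ?thesis
      by (simp add: sum.distrib)
  qed
  obtain x where x: "x \<in> X" "elimination (l i) x"
    using obtain_elimination[OF i] .
  interpret elimination "l i" x
    by (rule x(2))
  \<comment> \<open>The link of \<open>i\<close> in \<open>C\<close>: members through
    \<open>i\<close>, with \<open>i\<close> removed.\<close>
  define C' where "C' = {\<sigma> \<in> nsets (V - {i}) (Suc n). insert i \<sigma> \<in> C}"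
  \<comment> \<open>Each \<sigma> has \<open>Suc (Suc n)\<close> elements; taking
    \<open>w' i\<close> off each of them lowers the order by this multiple.\<close>
  have "c * real (m - Suc (Suc n) * w' i) \<le> real (d' + sum u (V - {i}))"
  proof (rule Suc.IH)
    show "arrangement (X - {x}) (V - {i}) (Suc n) (\<lambda>j. elim (l j)) (\<lambda>\<sigma>. p (insert i \<sigma>))"
      using i x by (intro arrangement_restrict) auto
    show "C' \<subseteq> nsets (V - {i}) (Suc n)"
      by (auto simp: C'_def)
    \<comment> \<open>One hyperplane is lost, but the left side drops by \<open>c\<close>, which is
      at least one.\<close>
    have "c * real (Suc n) \<le> real (card V) - 1"
      using Suc.prems(3) assms(3) by (simp add: algebra_simps)
    then show "c * real (Suc n) \<le> real (card (V - {i}))"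
      using i finite_V card_V by (simp add: of_nat_diff)
    show "elim F' \<noteq> 0"
      using elim_eq_0D F'(5) i by blast
    show "elim F' \<in> mpolys (X - {x})"
      using elim_mpolys l_mpolys[OF i] F'(2) by blast
    show "homogeneous d' (elim F')"
      using elim_homogeneous F'(3) by blast
  next
    fix \<tau> assume \<tau>: "\<tau> \<in> nsets (V - {i}) n"
    then have "insert i \<tau> \<in> nsets V (Suc n)"
      using i by (auto simp: nsets_def card_insert_if)
    then have "c \<le> real (card {\<sigma>\<in>C. insert i \<tau> \<subseteq> \<sigma>})"
      by (rule Suc.prems(4))
    also have "card {\<sigma>\<in>C. insert i \<tau> \<subseteq> \<sigma>} \<le> card {\<sigma>\<in>C'. \<tau> \<subseteq> \<sigma>}"
    proof (rule card_inj_on_le)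
      show "inj_on (\<lambda>\<sigma>. \<sigma> - {i}) {\<sigma>\<in>C. insert i \<tau> \<subseteq> \<sigma>}"
        by (auto simp: inj_on_def)
      have "\<sigma> - {i} \<in> C'" if "\<sigma> \<in> C" "i \<in> \<sigma>" for \<sigma>
        using that Suc.prems(2) by (auto simp: C'_def nsets_def insert_absorb)
      then show "(\<lambda>\<sigma>. \<sigma> - {i}) ` {\<sigma>\<in>C. insert i \<tau> \<subseteq> \<sigma>} \<subseteq> {\<sigma>\<in>C'. \<tau> \<subseteq> \<sigma>}"
        using \<tau> by (auto simp: nsets_def)
      have "finite (nsets (V - {i}) (Suc n))"
        using finite_V by (intro finite_imp_finite_nsets) auto
      then show "finite {\<sigma>\<in>C'. \<tau> \<subseteq> \<sigma>}"
        by (simp add: C'_def)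
    qed
    finally show "c \<le> real (card {\<sigma>\<in>C'. \<tau> \<subseteq> \<sigma>})"
      by simp
  next
    show "\<forall>\<sigma>\<in>C'. vanishes_at (p (insert i \<sigma>)) (m - Suc (Suc n) * w' i - sum u \<sigma>) (elim F')"
    proof
      fix \<sigma> assume \<sigma>: "\<sigma> \<in> C'"
      let ?\<sigma> = "insert i \<sigma>"
      have C: "?\<sigma> \<in> C" and i': "i \<notin> \<sigma>" "finite \<sigma>" "card \<sigma> = Suc n" "?\<sigma> \<subseteq> V"
        using \<sigma> i by (auto simp: C'_def nsets_def)
      have "sum w' ?\<sigma> = sum u \<sigma> + Suc (Suc n) * w' i"
        using i' sum_w'[of ?\<sigma>] by (simp add: u_def)
      then have "vanishes_at (p ?\<sigma>) (m - Suc (Suc n) * w' i - sum u \<sigma>) F'"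
        using bspec[OF F'(4) C] by (simp add: add.commute)
      moreover have "eval_mpoly (p ?\<sigma>) (l i) = 0"
        using eval_l[of ?\<sigma> i] C Suc.prems(2) i by auto
      ultimately show "vanishes_at (p ?\<sigma>) (m - Suc (Suc n) * w' i - sum u \<sigma>) (elim F')"
        by (auto simp: vanishes_at_iff expand_at_elim coeff_map_poly elim.hom_zero)
    qed
  qed
  moreover have "c * (real m - real (Suc (Suc n) * w' i)) \<le> c * real (m - Suc (Suc n) * w' i)"
  proof (rule mult_left_mono)
    show "real m - real k \<le> real (m - k)" for k
      by linarith
  qed (use assms(3) in simp)
  moreover have "sum u V = sum u (V - {i})"
    using i finite_V by (simp add: sum.remove[of V i] u_def)
  \<comment> \<open>The loss in order is paid for by the weight \<open>w' i\<close> carried by every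
    element of \<open>V\<close>; this is where the ratio of \<open>card V\<close> to the dimension
    bounds \<open>c\<close>.\<close>
  moreover have "c * real (Suc (Suc n)) * real (w' i) \<le> real (card V) * real (w' i)"
    using Suc.prems(3) by (intro mult_right_mono) auto
  ultimately have "c * real m \<le> real (d' + sum u V) + real (card V) * real (w' i)"
    by (simp only: right_diff_distrib of_nat_mult mult.assoc)
  also have "\<dots> = real (d' + sum w' V)"
    using sum_w'[of V] by simp
  finally show ?case
    by (simp only: F'(6))
qed

section \<open>Steiner systems\<close>

lemma steiner_system_eqI:
  assumes "steiner_system t n v B" "b \<in> B" "b' \<in> B" "t \<le> card (b \<inter> b')"
  shows "b = b'"
proof -
  have b: "b \<subseteq> {1..v}" "finite b"
    using assms(1,2) by (auto simp: steiner_system_def nsets_def)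
  obtain T where T: "T \<subseteq> b \<inter> b'" "card T = t" "finite T"
    using obtain_subset_with_card_n[OF assms(4)] .
  then have "T \<in> nsets {1..v} t"
    using b by (auto simp: nsets_def)
  then have "\<exists>!b. b \<in> B \<and> T \<subseteq> b"
    using assms(1) by (simp add: steiner_system_def)
  then show ?thesis
    using assms(2,3) T(1) by blast
qed

text \<open>If \<open>v = n\<close>, the only \<open>n\<close>-subset is a block. If
  \<open>v = n + 1\<close>, any two blocks share at least \<open>n - 1 \<ge> t\<close> points and
  coincide, yet a point missed by one block lies in another.\<close>

lemma steiner_system_card_ge:
  assumes "0 < t" "t < n" "n \<le> v" "steiner_system t n v B" "B \<noteq> nsets {1..v} n"
  shows "n + 2 \<le> v"
proof (rule ccontr)
  assume v: "\<not> n + 2 \<le> v"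
  note B = assms(4)[unfolded steiner_system_def, THEN conjunct1]
  note uniq = assms(4)[unfolded steiner_system_def, THEN conjunct2]
  have ex: "\<exists>b\<in>B. T \<subseteq> b" if "T \<in> nsets {1..v} t" for T
    using bspec[OF uniq that] by (elim ex1E) blast
  have "{1..t} \<in> nsets {1..v} t"
    using assms(2,3) by (auto simp: nsets_def)
  then obtain b where b: "b \<in> B"
    using ex by blast
  then have b': "b \<subseteq> {1..v}" "card b = n" "finite b"
    using B by (auto simp: nsets_def)
  show False
  proof (cases "v = n")
    case True
    then have all: "\<sigma> = {1..v}" if "\<sigma> \<in> nsets {1..v} n" for \<sigma>
      using that card_subset_eq[of "{1..v}" \<sigma>] by (simp add: nsets_def)
    have "nsets {1..v} n \<subseteq> B"
    proof
      fix \<sigma> assume "\<sigma> \<in> nsets {1..v} n"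
      then have "\<sigma> = b"
        using all b B by blast
      then show "\<sigma> \<in> B"
        using b by simp
    qed
    then show False
      using B assms(5) by blast
  next
    case False
    then have "v = n + 1"
      using v assms(3) by simp
    then have "card ({1..v} - b) = 1"
      using b' by (simp add: card_Diff_subset)
    then obtain a where a: "{1..v} - b = {a}"
      by (auto simp: card_1_singleton_iff)
    \<comment> \<open>Together with the missed point \<open>a\<close> this makes a
      \<open>t\<close>-set, whose block contains \<open>a\<close>; here \<open>t > 0\<close>
      enters.\<close>
    obtain S where S: "S \<subseteq> b" "card S = t - 1" "finite S"
    proof (rule obtain_subset_with_card_n)
      show "t - 1 \<le> card b"
        using b'(2) assms(2) by simp
    qed
    have "a \<notin> S" "a \<in> {1..v}"
      using a S(1) by auto
    then have "insert a S \<in> nsets {1..v} t"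
      using S b'(1) assms(1) by (auto simp: nsets_def)
    then obtain c where c: "c \<in> B" "a \<in> c"
      using ex by blast
    then have c': "c \<subseteq> {1..v}" "card c = n" "finite c"
      using B by (auto simp: nsets_def)
    have "card (b \<union> c) \<le> card {1..v}"
      using b' c' by (intro card_mono) auto
    then have "t \<le> card (b \<inter> c)"
      using card_Un_Int[OF b'(3) c'(3)] b' c' \<open>v = n + 1\<close> assms(2) by simp
    then have "b = c"
      using steiner_system_eqI[OF assms(4) b c(1)] by simp
    then show False
      using a c(2) by auto
  qed
qed

text \<open>There are \<open>v - n + 1\<close> ways to add a point to \<tau>. At most one yields a
  block, because \<tau> has \<open>n - 1 \<ge> t\<close> elements.\<close>

lemma card_complement_blocks_ge:
  assumes "t < n" "n < v" "steiner_system t n v B" "\<tau> \<in> nsets {1..v} (n - 1)"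
  shows "v - n \<le> card {\<sigma> \<in> nsets {1..v} n - B. \<tau> \<subseteq> \<sigma>}"
proof -
  let ?N = "{\<sigma> \<in> nsets {1..v} n. \<tau> \<subseteq> \<sigma>}" and ?D = "{\<sigma> \<in> B. \<tau> \<subseteq> \<sigma>}"
  have \<tau>: "\<tau> \<subseteq> {1..v}" "finite \<tau>" "card \<tau> = n - 1"
    using assms(4) by (auto simp: nsets_def)
  have fin: "finite ?N"
    using finite_imp_finite_nsets[of "{1..v}" n] by simp
  have "\<forall>b\<in>?D. \<forall>b'\<in>?D. b = b'"
  proof (intro ballI)
    fix b b' assume *: "b \<in> ?D" "b' \<in> ?D"
    then have "finite b"
      using assms(3) by (auto simp: steiner_system_def nsets_def)
    then have "card \<tau> \<le> card (b \<inter> b')"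
      using * by (intro card_mono) auto
    then show "b = b'"
      using * steiner_system_eqI[OF assms(3)] \<tau>(3) assms(1) by auto
  qed
  moreover have "finite ?D"
    using assms(3) by (intro finite_subset[OF _ fin]) (auto simp: steiner_system_def)
  ultimately have D: "card ?D \<le> 1"
    by (simp add: card_le_Suc0_iff_eq)
  have "v - (n - 1) = card ({1..v} - \<tau>)"
    using \<tau> by (simp add: card_Diff_subset)
  also have "\<dots> \<le> card ?N"
  proof (rule card_inj_on_le[OF _ _ fin])
    show "inj_on (\<lambda>x. insert x \<tau>) ({1..v} - \<tau>)"
      by (auto simp: inj_on_def)
    show "(\<lambda>x. insert x \<tau>) ` ({1..v} - \<tau>) \<subseteq> ?N"
      using \<tau> assms(1) by (auto simp: nsets_def)
  qed
  finally have "v - n \<le> card ?N - card ?D"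
    using D assms(1) by linarith
  also have "\<dots> \<le> card (?N - ?D)"
    by (rule diff_card_le_card_Diff) (use \<open>finite ?D\<close> in simp)
  also have "?N - ?D = {\<sigma> \<in> nsets {1..v} n - B. \<tau> \<subseteq> \<sigma>}"
    by auto
  finally show ?thesis .
qed

section \<open>Powers of point ideals\<close>

interpretation poly_ring: cring "poly_ring n"
  by (rule poly_ring_cring)

lemma poly_ring_simps:
  "monoid.mult (poly_ring n) = (*)" "one (poly_ring n) = 1" "zero (poly_ring n) = 0" "add (poly_ring n) = (+)"
  by (simp_all add: poly_ring_def)

lemma ideal_poly_ringI:
  assumes "I \<subseteq> mpolys {0..n}" "0 \<in> I" "\<And>f g. f \<in> I \<Longrightarrow> g \<in> I \<Longrightarrow> f + g \<in> I"
    and "\<And>f g. f \<in> I \<Longrightarrow> g \<in> mpolys {0..n} \<Longrightarrow> g * f \<in> I"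
  shows "ideal I (poly_ring n)"
proof (rule idealI)
  show "ring (poly_ring n :: 'a mpoly ring)"
    by (rule poly_ring.ring_axioms)
  show "subgroup I (add_monoid (poly_ring n))"
  proof (rule group.subgroupI)
    show "Group.group (add_monoid (poly_ring n :: 'a mpoly ring))"
      by (rule poly_ring.a_group)
    fix f assume f: "f \<in> I"
    have "const (- 1) * f \<in> I"
      using f by (rule assms(4)) simp
    then have neg: "- f \<in> I"
      by (simp add: const.hom_uminus)
    then have "\<ominus>\<^bsub>poly_ring n\<^esub> f = - f"
      using f assms(1) by (intro poly_ring.minus_equality) (auto simp: poly_ring_simps carrier_poly_ring)
    then show "inv\<^bsub>add_monoid (poly_ring n)\<^esub> f \<in> I"
      using neg by (simp add: a_inv_def)
  qed (use assms in \<open>auto simp: carrier_poly_ring poly_ring_simps\<close>)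
qed (use assms(4) in \<open>auto simp: carrier_poly_ring poly_ring_simps mult.commute\<close>)

lemma ideal_point_ideal:
  assumes "\<And>i. i \<in> \<sigma> \<Longrightarrow> l i \<in> mpolys {0..n}"
  shows "ideal (point_ideal n l \<sigma>) (poly_ring n)"
  unfolding point_ideal_def using assms
  by (intro poly_ring.genideal_ideal) (auto simp: carrier_poly_ring)

text \<open>The polynomials vanishing at \<open>p\<close> form an ideal that contains the
  generators.\<close>

lemma point_ideal_vanishes_at:
  assumes "\<And>i. i \<in> \<sigma> \<Longrightarrow> l i \<in> mpolys {0..n}" "\<And>i. i \<in> \<sigma> \<Longrightarrow> homogeneous 1 (l i)"
    and "\<And>i. i \<in> \<sigma> \<Longrightarrow> eval_mpoly p (l i) = 0" "F \<in> point_ideal n l \<sigma>"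
  shows "vanishes_at p 1 F"
proof -
  define I where "I = {F \<in> mpolys {0..n}. vanishes_at p 1 F}"
  have "ideal I (poly_ring n)"
    by (rule ideal_poly_ringI)
       (auto simp: I_def vanishes_at_def expand_at.hom_zero expand_at.hom_add expand_at.hom_mult
         mpolys_add mpolys_mult)
  moreover have "l ` \<sigma> \<subseteq> I"
    using assms(1-3) by (auto simp: I_def vanishes_at_iff expand_at_homogeneous_1[unfolded One_nat_def])
  ultimately have "point_ideal n l \<sigma> \<subseteq> I"
    unfolding point_ideal_def by (rule poly_ring.genideal_minimal)
  then show ?thesis
    using assms(4) by (auto simp: I_def)
qed

interpretation ideals: Group.comm_monoid "ideals_set (poly_ring n)"
  by (rule poly_ring.ideals_set_is_comm_monoid)

lemma ideals_set_simps:
  "carrier (ideals_set R) = {I. ideal I R}" "monoid.mult (ideals_set R) = ideal_prod R"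
  "one (ideals_set R) = carrier R"
  by (simp_all add: ideals_set_def)

text \<open>Orders of vanishing add under products and survive sums, the two operations generating
  an ideal product.\<close>

lemma vanishes_at_ideal_power:
  assumes "\<And>F. F \<in> I \<Longrightarrow> vanishes_at p 1 F"
    and "F \<in> I [^]\<^bsub>ideals_set (poly_ring n)\<^esub> (m::nat)"
  shows "vanishes_at p m F"
  using assms(2)
proof (induction m arbitrary: F)
  case 0
  then show ?case
    by (simp add: vanishes_at_iff)
next
  case (Suc m)
  have "F \<in> ideal_prod (poly_ring n) (I [^]\<^bsub>ideals_set (poly_ring n)\<^esub> m) I"
    using Suc.prems by (simp add: ideals_set_simps)
  then show ?case
  proof (induction rule: ideal_prod.induct)
    case (prod f g)
    have "Polynomial.monom 1 m * Polynomial.monom 1 1 dvd expand_at p f * expand_at p g"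
      using Suc.IH[OF prod(1)] assms(1)[OF prod(2)] unfolding vanishes_at_def by (rule mult_dvd_mono)
    then show ?case
      by (simp add: vanishes_at_def mult_monom expand_at.hom_mult poly_ring_simps)
  next
    case (sum f g)
    then show ?case
      by (simp add: vanishes_at_def expand_at.hom_add poly_ring_simps)
  qed
qed

context
  fixes n :: nat and I :: "'k::field mpoly set"
  assumes ideal_I: "ideal I (poly_ring n)"
begin

abbreviation ideal_power :: "nat \<Rightarrow> 'k mpoly set" where
  "ideal_power m \<equiv> I [^]\<^bsub>ideals_set (poly_ring n)\<^esub> m"

lemma ideal_ideal_power: "ideal (ideal_power m) (poly_ring n)"
  using ideals.nat_pow_closed[of I n m] ideal_I by (simp add: ideals_set_simps)

lemma ideal_power_add:
  "ideal_power (a + b) = ideal_prod (poly_ring n) (ideal_power a) (ideal_power b)"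
  using ideals.nat_pow_mult[of I n a b] ideal_I by (simp add: ideals_set_simps)

lemma ideal_power_mult:
  assumes "f \<in> ideal_power a" "g \<in> ideal_power b"
  shows "f * g \<in> ideal_power (a + b)"
  using ideal_prod.prod[OF assms, of "poly_ring n"] by (simp add: ideal_power_add poly_ring_simps)

text \<open>Split \<open>a\<close> as \<open>m + (a - m)\<close>; a product of ideals lies in each
  factor.\<close>

lemma ideal_power_antimono:
  assumes "m \<le> a" "f \<in> ideal_power a"
  shows "f \<in> ideal_power m"
proof -
  have "f \<in> ideal_prod (poly_ring n) (ideal_power m) (ideal_power (a - m))"
    using assms ideal_power_add[of m "a - m"] by simp
  then show ?thesis
    using poly_ring.ideal_prod_inter[OF ideal_ideal_power ideal_ideal_power] by blast
qed

lemma ideal_power_0: "ideal_power 0 = mpolys {0..n}"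
  by (simp add: ideals_set_simps carrier_poly_ring)

lemma ideal_power_1: "ideal_power 1 = I"
  using ideals.l_one[of I n] ideal_I by (simp add: ideals_set_simps)

lemma ideal_power_prod:
  assumes "finite A" "\<And>i. i \<in> A \<Longrightarrow> f i \<in> I"
  shows "prod f A \<in> ideal_power (card A)"
  using assms
proof (induction A rule: finite_induct)
  case empty
  then show ?case
    by (simp only: ideal_power_0 card.empty prod.empty mpolys_1)
next
  case (insert i A)
  then show ?case
    using ideal_power_mult[of "f i" 1 "prod f A" "card A"] unfolding ideal_power_1 by simp
qed

lemma ideal_power_power:
  assumes "f \<in> ideal_power a"
  shows "f ^ k \<in> ideal_power (a * k)"
proof (induction k)
  case 0
  then show ?case
    by (simp only: ideal_power_0 power_0 mult_0_right mpolys_1)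
next
  case (Suc k)
  then show ?case
    using ideal_power_mult[OF assms Suc] by simp
qed

end

section \<open>Homogeneity of products and powers\<close>

lemma homogeneous_mult:
  assumes "homogeneous a f" "homogeneous b g"
  shows "homogeneous (a + b) (f * g)"
  using assms by (simp add: homogeneous_iff_expand_at_0 expand_at.hom_mult mult_monom)

lemma homogeneous_one: "homogeneous 0 1"
  by (simp add: homogeneous_iff_expand_at_0 expand_at.hom_one)

lemma homogeneous_prod_1:
  assumes "finite A" "\<And>i. i \<in> A \<Longrightarrow> homogeneous 1 (f i)"
  shows "homogeneous (card A) (prod f A)"
  using assms
proof (induction A rule: finite_induct)
  case (insert i A)
  then show ?case
    using homogeneous_mult[of 1 "f i" "card A" "prod f A"] by simp
qed (simp add: homogeneous_one)

lemma homogeneous_power: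
  assumes "homogeneous d f"
  shows "homogeneous (d * k) (f ^ k)"
proof (induction k)
  case (Suc k)
  then show ?case
    using homogeneous_mult[OF assms Suc] by simp
qed (simp add: homogeneous_one)

section \<open>The Waldschmidt constant\<close>

text \<open>If a further hyperplane passed through the point of \<sigma>, exchanging an element of
  \<sigma> for its index would give a different \<open>n\<close>-set with the same point, against
  injectivity.\<close>

lemma config_point_coordinates:
  assumes lin: "\<And>i. i \<in> {1..v} \<Longrightarrow> linear_form n (l i)"
    and meet: "\<And>\<sigma>. \<sigma> \<in> nsets {1..v} n \<Longrightarrow> \<exists>P. (\<Inter>i\<in>\<sigma>. hyperplane n (l i)) = {P}"
    and inj: "inj_on (config_point n l) (nsets {1..v} n)"
    and "0 < n" "\<sigma> \<in> nsets {1..v} n"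
  shows "\<exists>x. \<forall>j\<in>{1..v}. eval_mpoly x (l j) = 0 \<longleftrightarrow> j \<in> \<sigma>"
proof -
  have \<sigma>: "\<sigma> \<subseteq> {1..v}" "finite \<sigma>" "card \<sigma> = n"
    using assms(5) by (auto simp: nsets_def)
  then obtain a where a: "a \<in> \<sigma>"
    using \<open>0 < n\<close> by fastforce
  obtain P where P: "(\<Inter>i\<in>\<sigma>. hyperplane n (l i)) = {P}"
    using meet[OF assms(5)] by blast
  then have P_in: "P \<in> hyperplane n (l i)" if "i \<in> \<sigma>" for i
    using that by blast
  then have P_proj: "P \<in> proj_space n"
    using a by (auto simp: hyperplane_def)
  then obtain x where x: "P = {\<lambda>i. c * x i | c. c \<noteq> 0}"
    by (auto simp: proj_space_def)
  then have "x \<in> P"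
    by (auto intro!: exI[of _ 1])
  have "eval_mpoly x (l j) \<noteq> 0" if j: "j \<in> {1..v}" "j \<notin> \<sigma>" for j
  proof
    assume 0: "eval_mpoly x (l j) = 0"
    have "homogeneous 1 (l j)"
      using lin[OF j(1)] by (simp add: linear_form_def)
    then have "eval_mpoly y (l j) = 0" if "y \<in> P" for y
      using that x 0 by (auto simp: eval_mpoly_eq_subst homogeneous_1_subst_scale[unfolded One_nat_def])
    then have P_j: "P \<in> hyperplane n (l j)"
      using P_proj by (simp add: hyperplane_def)
    define \<sigma>' where "\<sigma>' = insert j (\<sigma> - {a})"
    have \<sigma>': "\<sigma>' \<in> nsets {1..v} n"
      using \<sigma> a j \<open>0 < n\<close> by (auto simp: \<sigma>'_def nsets_def)
    moreover have "P \<in> (\<Inter>i\<in>\<sigma>'. hyperplane n (l i))"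
      using P_j P_in by (auto simp: \<sigma>'_def)
    ultimately have "(\<Inter>i\<in>\<sigma>'. hyperplane n (l i)) = {P}"
      using meet by (metis singletonD)
    then have "config_point n l \<sigma>' = config_point n l \<sigma>"
      by (simp only: config_point_def P)
    then have "\<sigma>' = \<sigma>"
      using inj_onD[OF inj] \<sigma>' assms(5) by blast
    then show False
      using j(2) by (auto simp: \<sigma>'_def)
  qed
  moreover have "eval_mpoly x (l j) = 0" if "j \<in> \<sigma>" for j
    using P_in[OF that] \<open>x \<in> P\<close> by (simp add: hyperplane_def)
  ultimately show ?thesis
    by blast
qed

text \<open>A nonempty configuration excludes the case where all \<open>n\<close>-subsets are
  blocks. The assumption \<open>0 < t\<close> excludes a single block with \<open>v = n + 1\<close>,
  where all points lie on one hyperplane and the constant is at most 1.\<close>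

theorem corollary3p12:
  fixes t n v :: nat
    and B C :: "nat set set"
    and l :: "nat \<Rightarrow> ('k::field) mpoly"
  assumes "0 < t" and "t < n" and "n \<le> v"
    and "steiner_system t n v B"
    and "C = nsets {1..v} n - B"
    and "\<And>i. i \<in> {1..v} \<Longrightarrow> linear_form n (l i)"
    and "inj_on (\<lambda>i. hyperplane n (l i)) {1..v}"
    and "\<And>\<sigma>. \<sigma> \<in> nsets {1..v} n \<Longrightarrow> \<exists>P. (\<Inter>i\<in>\<sigma>. hyperplane n (l i)) = {P}"
    and "inj_on (config_point n l) (nsets {1..v} n)"
    and "configuration n l C \<noteq> {}"
  shows "has_waldschmidt_constant (config_symbolic_power n l C) (real v / real n)"
proof -
  have "B \<noteq> nsets {1..v} n"
    using assms(5,10) by (auto simp: configuration_def)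
  then have v: "n + 2 \<le> v"
    using steiner_system_card_ge[OF assms(1-4)] by simp
  have n: "n = Suc (n - 1)" "2 \<le> n"
    using assms(1,2) by auto
  have l_mpolys: "l j \<in> mpolys {0..n}" and l_hom: "homogeneous 1 (l j)" and l_ne: "l j \<noteq> 0"
    if "j \<in> {1..v}" for j
    using assms(6)[OF that] by (simp_all add: linear_form_def carrier_poly_ring)
  have C: "C \<subseteq> nsets {1..v} n"
    using assms(5) by simp
  have "\<forall>\<sigma>\<in>nsets {1..v} n. \<exists>x. \<forall>j\<in>{1..v}. eval_mpoly x (l j) = 0 \<longleftrightarrow> j \<in> \<sigma>"
    using config_point_coordinates[OF assms(6,8,9)] n(2) by simp
  then obtain p where
    p: "\<forall>\<sigma>\<in>nsets {1..v} n. \<forall>j\<in>{1..v}. eval_mpoly (p \<sigma>) (l j) = 0 \<longleftrightarrow> j \<in> \<sigma>"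
    by (rule bchoice[THEN exE])
  have arr: "arrangement {0..n} {1..v} (Suc (n - 1)) l p"
    using v n(1) l_mpolys l_hom p by unfold_locales auto
  define J where "J = config_symbolic_power n l C"
  define c where "c = real v / real n"
  define G where "G = (\<Prod>i\<in>{1..v}. l i)"
  have "G \<noteq> 0"
    using l_ne by (simp add: G_def)
  have "homogeneous v G"
    using homogeneous_prod_1[of "{1..v}" l] l_hom by (simp add: G_def)
  \<comment> \<open>Exactly \<open>n\<close> of the factors of \<open>G\<close> lie in each point
    ideal, so \<open>G\<close> is in its \<open>n\<close>-th power.\<close>
  have G_J: "G ^ k \<in> J m" if "m \<le> n * k" for k m
    unfolding J_def config_symbolic_power_def
  proof (intro CollectI conjI ballI)
    show "G ^ k \<in> carrier (poly_ring n)"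
      unfolding carrier_poly_ring G_def using l_mpolys by (intro mpolys_power mpolys_prod) auto
  next
    fix \<sigma> assume "\<sigma> \<in> C"
    then have \<sigma>: "\<sigma> \<subseteq> {1..v}" "card \<sigma> = n" "finite \<sigma>"
      using C by (auto simp: nsets_def)
    let ?I = "point_ideal n l \<sigma>"
    have I: "ideal ?I (poly_ring n)"
      using \<sigma> l_mpolys by (intro ideal_point_ideal) auto
    have "l ` \<sigma> \<subseteq> ?I"
      unfolding point_ideal_def
      using \<sigma> l_mpolys by (intro poly_ring.genideal_self) (auto simp: carrier_poly_ring)
    then have "(\<Prod>i\<in>\<sigma>. l i) \<in> ?I [^]\<^bsub>ideals_set (poly_ring n)\<^esub> card \<sigma>"
      using \<sigma> by (intro ideal_power_prod[OF I]) auto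
    moreover have "(\<Prod>i\<in>{1..v} - \<sigma>. l i) \<in> ?I [^]\<^bsub>ideals_set (poly_ring n)\<^esub> (0::nat)"
      unfolding ideal_power_0[OF I] using l_mpolys by (intro mpolys_prod) auto
    moreover have "G = (\<Prod>i\<in>\<sigma>. l i) * (\<Prod>i\<in>{1..v} - \<sigma>. l i)"
      unfolding G_def using \<sigma> by (metis finite_atLeastAtMost mult.commute prod.subset_diff)
    ultimately have "G \<in> ?I [^]\<^bsub>ideals_set (poly_ring n)\<^esub> n"
      using ideal_power_mult[OF I] \<sigma>(2) by (metis add.right_neutral)
    then show "G ^ k \<in> ?I [^]\<^bsub>ideals_set (poly_ring n)\<^esub> m"
      using ideal_power_antimono[OF I that ideal_power_power[OF I]] by blast
  qed
  \<comment> \<open>The exponent \<open>m div n + 1\<close> suffices for order \<open>m\<close>; its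
    rounding error is bounded and vanishes in the limit.\<close>
  have upper: "initial_degree (J m) \<le> v * (m div n + 1)" for m
    unfolding initial_degree_def
  proof (rule Least_le, intro bexI conjI)
    show "homogeneous (v * (m div n + 1)) (G ^ (m div n + 1))"
      using \<open>homogeneous v G\<close> by (rule homogeneous_power)
    show "G ^ (m div n + 1) \<noteq> 0"
      using \<open>G \<noteq> 0\<close> by simp
    show "G ^ (m div n + 1) \<in> J m"
    proof (rule G_J)
      show "m \<le> n * (m div n + 1)"
        using dividend_less_times_div[of n m] n by simp
    qed
  qed
  have c: "1 \<le> c" "c * real (Suc (n - 1)) \<le> real (card {1..v})"
    using v n by (simp_all add: c_def)
  have c_le: "c \<le> real (card {\<sigma>\<in>C. \<tau> \<subseteq> \<sigma>})" if "\<tau> \<in> nsets {1..v} (n - 1)" for \<tau>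
  proof -
    obtain a b where ab: "n = a + 2" "v = n + 2 + b"
      using n(2) v le_Suc_ex by (metis add.commute)
    \<comment> \<open>This uses \<open>n \<ge> 2\<close> and \<open>v \<ge> n + 2\<close>: the
      difference of the two sides is \<open>a + (n - 1) * b\<close>.\<close>
    have "v \<le> n * (v - n)"
      by (simp add: ab algebra_simps)
    then have "real v \<le> real n * real (v - n)"
      by (simp only: of_nat_le_iff flip: of_nat_mult)
    then have "c \<le> real (v - n)"
      using n(2) by (simp add: c_def divide_le_eq mult.commute)
    also have "\<dots> \<le> real (card {\<sigma>\<in>C. \<tau> \<subseteq> \<sigma>})"
      unfolding of_nat_le_iff assms(5) using v by (intro card_complement_blocks_ge[OF assms(2) _ assms(4) that]) simp
    finally show ?thesis .
  qed
  have lower: "c * real m \<le> real (initial_degree (J m))" for m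
  proof -
    \<comment> \<open>Existence of a form ensures that the minimum in \<open>initial_degree\<close>
      is attained.\<close>
    have "\<exists>d. \<exists>f\<in>J m. homogeneous d f \<and> f \<noteq> 0"
    proof (intro exI bexI conjI)
      show "G ^ m \<in> J m"
        using n by (intro G_J) simp
      show "homogeneous (v * m) (G ^ m)"
        using \<open>homogeneous v G\<close> by (rule homogeneous_power)
    qed (use \<open>G \<noteq> 0\<close> in simp)
    then obtain F where F: "F \<in> J m" "homogeneous (initial_degree (J m)) F" "F \<noteq> 0"
      unfolding initial_degree_def by (rule LeastI_ex[THEN bexE]) blast
    have "vanishes_at (p \<sigma>) m F" if \<sigma>: "\<sigma> \<in> C" for \<sigma>
    proof (rule vanishes_at_ideal_power)
      have "\<sigma> \<in> nsets {1..v} n" "\<sigma> \<subseteq> {1..v}"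
        using \<sigma> C by (auto simp: nsets_def)
      then show "vanishes_at (p \<sigma>) 1 F" if "F \<in> point_ideal n l \<sigma>" for F
        using that p l_mpolys l_hom by (intro point_ideal_vanishes_at[of \<sigma> l n]) auto
      show "F \<in> point_ideal n l \<sigma> [^]\<^bsub>ideals_set (poly_ring n)\<^esub> m"
        using F(1) \<sigma> by (simp add: J_def config_symbolic_power_def)
    qed
    \<comment> \<open>All weights start at zero.\<close>
    then have "c * real m \<le> real (initial_degree (J m) + sum (\<lambda>_. 0) {1..v})"
      using F C n c c_le
      by (intro arrangement_degree_bound[OF arr])
         (auto simp: J_def config_symbolic_power_def carrier_poly_ring)
    then show ?thesis
      by simp
  qed
  have "(\<lambda>m. real (initial_degree (J m)) / real m) \<longlonglongrightarrow> c"
  proof (rule real_tendsto_sandwich)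
    show "\<forall>\<^sub>F m in sequentially. c \<le> real (initial_degree (J m)) / real m"
      using eventually_gt_at_top[of 0] by eventually_elim (use lower in \<open>simp add: field_simps\<close>)
    show "\<forall>\<^sub>F m in sequentially. real (initial_degree (J m)) / real m \<le> c + real v / real m"
      using eventually_gt_at_top[of 0]
    proof eventually_elim
      case (elim m)
      have "real (initial_degree (J m)) \<le> real (v * (m div n + 1))"
        using upper[of m] by (simp only: of_nat_le_iff)
      also have "\<dots> = real v * real (m div n) + real v"
        by (simp add: algebra_simps)
      also have "\<dots> \<le> real v * (real m / real n) + real v"
        by (intro add_right_mono mult_left_mono of_nat_div_le_of_nat) auto
      finally show ?case
        using elim by (simp add: c_def field_simps)
    qed
    have "(\<lambda>m. c + real v / real m) \<longlonglongrightarrow> c + 0"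
      by (intro tendsto_add tendsto_const lim_const_over_n)
    then show "(\<lambda>m. c + real v / real m) \<longlonglongrightarrow> c"
      by simp
  qed simp
  then show ?thesis
    by (simp add: has_waldschmidt_constant_def J_def c_def)
qed

end
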